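(* Let $\Sigma$ be a complete properly immersed self-expander hypersurface in $\mathbb{R}^{n+1}$. Assume that its mean curvature $H$ is bounded from below and satisfies $H(x)\le a|x|+b$ for all $x\in\Sigma$, for some constants $0\le a<\frac12$ and $b>0$. If there exists $\alpha>\frac{4a^2}{1-4a^2}$ such that $$|A|^2H+\frac{H}{2}+\frac{\alpha+1}{4}A(x^T,x^T)\ge0\quad\text{on }\Sigma,$$ then $\Sigma$ must be a hyperplane $\mathbb{R}^n$ through the origin.
   Context: $x$ denotes the position vector, $x^T$ and $x^\perp$ its tangent and normal components along the (connected) immersed hypersurface $\Sigma$. The second fundamental form is $A(X,Y)=(\overline\nabla_XY)^\perp$ ($\overline\nabla$ the Euclidean connection) and the mean curvature vector $\mathbf{H}$ is the trace of $A$. $\Sigma$ is a self-expander if $\mathbf{H}=\frac12x^\perp$. With $\mathbf{n}$ the unit normal field on $\Sigma$, the mean curvature $H$ is defined by $\mathbf{H}=-H\mathbf{n}$, so that $H=-\frac12\langle x,\mathbf{n}\rangle$; the scalar $A(x^T,x^T)$ means $\langle A(x^T,x^T),\mathbf{n}\rangle$, with the same $\mathbf{n}$. $\Sigma$ is properly immersed if the preimage under the immersion of every compact subset of $\mathbb{R}^{n+1}$ is compact. *)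

theory Defs
  imports "HOL-Analysis.Analysis"
begin

section \<open>Smooth manifolds and maps\<close>

(* On an open subset of a finite-dimensional space this is the usual notion of class C^k:
   differentiable, with all directional derivatives of class C^(k-1). *)
primrec Ck_on :: "nat \<Rightarrow> ('a::euclidean_space \<Rightarrow> 'b::euclidean_space) \<Rightarrow> 'a set \<Rightarrow> bool" where
  "Ck_on 0 f S \<longleftrightarrow> continuous_on S f"
| "Ck_on (Suc k) f S \<longleftrightarrow>
     (\<forall>x\<in>S. f differentiable (at x)) \<and>
     (\<forall>v. Ck_on k (\<lambda>x. frechet_derivative f (at x) v) S)"

definition smooth_on :: "('a::euclidean_space \<Rightarrow> 'b::euclidean_space) \<Rightarrow> 'a set \<Rightarrow> bool" where
  "smooth_on f S \<longleftrightarrow> (\<forall>k. Ck_on k f S)"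

(* An atlas is a set of local parametrizations (V, \<psi>): V is the parameter domain in the model space
   'a, and \<psi> maps V homeomorphically onto an open subset of the manifold.  The manifold is the whole
   type 'm; the Hausdorff and second countability axioms are carried by its type class. *)
type_synonym ('a, 'm) atlas = "('a set \<times> ('a \<Rightarrow> 'm)) set"

definition smooth_atlas ::
  "('a::euclidean_space, 'm::{t2_space, second_countable_topology}) atlas \<Rightarrow> bool" where
  "smooth_atlas \<A> \<longleftrightarrow>
     (\<forall>(V, \<psi>)\<in>\<A>. open V \<and> open (\<psi> ` V) \<and> (\<exists>\<phi>. homeomorphism V (\<psi> ` V) \<psi> \<phi>)) \<and>
     (\<Union>(V, \<psi>)\<in>\<A>. \<psi> ` V) = UNIV \<and>
     (\<forall>(V, \<psi>)\<in>\<A>. \<forall>(W, \<eta>)\<in>\<A>. smooth_on (\<lambda>u. inv_into W \<eta> (\<psi> u)) (V \<inter> \<psi> -` (\<eta> ` W)))"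

definition smooth_map :: "('a::euclidean_space, 'm) atlas \<Rightarrow> ('m \<Rightarrow> 'b::euclidean_space) \<Rightarrow> bool" where
  "smooth_map \<A> f \<longleftrightarrow> (\<forall>(V, \<psi>)\<in>\<A>. smooth_on (f \<circ> \<psi>) V)"

definition immersion :: "('a::euclidean_space, 'm) atlas \<Rightarrow> ('m \<Rightarrow> 'b::euclidean_space) \<Rightarrow> bool" where
  "immersion \<A> F \<longleftrightarrow> smooth_map \<A> F \<and>
     (\<forall>(V, \<psi>)\<in>\<A>. \<forall>u\<in>V. inj (frechet_derivative (F \<circ> \<psi>) (at u)))"

definition proper_map_into :: "('m::topological_space \<Rightarrow> 'b::euclidean_space) \<Rightarrow> bool" where
  "proper_map_into F \<longleftrightarrow> (\<forall>K. compact K \<longrightarrow> compact (F -` K))"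

section \<open>Extrinsic geometry of an immersion\<close>

(* The pointwise notions below are computed in an arbitrarily chosen parametrization around p and in
   an arbitrarily chosen orthonormal basis; they do not depend on these choices. *)
definition param_at :: "('a, 'm) atlas \<Rightarrow> 'm \<Rightarrow> 'a set \<times> ('a \<Rightarrow> 'm)" where
  "param_at \<A> p = (SOME (V, \<psi>). (V, \<psi>) \<in> \<A> \<and> p \<in> \<psi> ` V)"

definition coord_at :: "('a, 'm) atlas \<Rightarrow> 'm \<Rightarrow> 'a" where
  "coord_at \<A> p = (case param_at \<A> p of (V, \<psi>) \<Rightarrow> inv_into V \<psi> p)"

definition local_rep :: "('a, 'm) atlas \<Rightarrow> ('m \<Rightarrow> 'b) \<Rightarrow> 'm \<Rightarrow> 'a \<Rightarrow> 'b" where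
  "local_rep \<A> F p = F \<circ> snd (param_at \<A> p)"

(* The image of the differential of F, as a linear subspace of the ambient space. *)
definition tangent_space ::
  "('a::euclidean_space, 'm) atlas \<Rightarrow> ('m \<Rightarrow> 'b::euclidean_space) \<Rightarrow> 'm \<Rightarrow> 'b set" where
  "tangent_space \<A> F p = range (frechet_derivative (local_rep \<A> F p) (at (coord_at \<A> p)))"

definition tangential_part ::
  "('a::euclidean_space, 'm) atlas \<Rightarrow> ('m \<Rightarrow> 'b::euclidean_space) \<Rightarrow> 'm \<Rightarrow> 'b \<Rightarrow> 'b" where
  "tangential_part \<A> F p x =
     (THE y. y \<in> tangent_space \<A> F p \<and> (\<forall>z\<in>tangent_space \<A> F p. orthogonal (x - y) z))"

definition normal_part ::
  "('a::euclidean_space, 'm) atlas \<Rightarrow> ('m \<Rightarrow> 'b::euclidean_space) \<Rightarrow> 'm \<Rightarrow> 'b \<Rightarrow> 'b" where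
  "normal_part \<A> F p x = x - tangential_part \<A> F p x"

(* A(X,Y) is the normal part of the Euclidean derivative of a tangent extension of Y in direction X.
   With f the local representation of F and u the parameter of p, tangent vectors at p are
   X = df_u(v) and Y = df_u(w) for unique v, w; Y is extended by the coordinate field u' |-> df_u'(w),
   which is differentiated at u in direction v.  Meaningful for X, Y in the tangent space only. *)
definition second_fundamental_form ::
  "('a::euclidean_space, 'm) atlas \<Rightarrow> ('m \<Rightarrow> 'b::euclidean_space) \<Rightarrow> 'm \<Rightarrow> 'b \<Rightarrow> 'b \<Rightarrow> 'b" where
  "second_fundamental_form \<A> F p X Y =
     (let f = local_rep \<A> F p; u = coord_at \<A> p;
          v = inv (frechet_derivative f (at u)) X;
          w = inv (frechet_derivative f (at u)) Y
      in normal_part \<A> F p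
           (frechet_derivative (\<lambda>u'. frechet_derivative f (at u') w) (at u) v))"

definition orthonormal_frame ::
  "('a::euclidean_space, 'm) atlas \<Rightarrow> ('m \<Rightarrow> 'b::euclidean_space) \<Rightarrow> 'm \<Rightarrow> 'b set" where
  "orthonormal_frame \<A> F p =
     (SOME B. pairwise orthogonal B \<and> (\<forall>e\<in>B. norm e = 1) \<and> span B = tangent_space \<A> F p)"

definition mean_curvature_vector ::
  "('a::euclidean_space, 'm) atlas \<Rightarrow> ('m \<Rightarrow> 'b::euclidean_space) \<Rightarrow> 'm \<Rightarrow> 'b" where
  "mean_curvature_vector \<A> F p =
     (\<Sum>e\<in>orthonormal_frame \<A> F p. second_fundamental_form \<A> F p e e)"

definition norm_sq_sff ::
  "('a::euclidean_space, 'm) atlas \<Rightarrow> ('m \<Rightarrow> 'b::euclidean_space) \<Rightarrow> 'm \<Rightarrow> real" where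
  "norm_sq_sff \<A> F p =
     (\<Sum>e\<in>orthonormal_frame \<A> F p. \<Sum>e'\<in>orthonormal_frame \<A> F p.
        (norm (second_fundamental_form \<A> F p e e'))\<^sup>2)"

definition unit_normal_field ::
  "('a::euclidean_space, 'm) atlas \<Rightarrow> ('m \<Rightarrow> 'b::euclidean_space) \<Rightarrow> ('m \<Rightarrow> 'b) \<Rightarrow> bool" where
  "unit_normal_field \<A> F N \<longleftrightarrow> smooth_map \<A> N \<and>
     (\<forall>p. norm (N p) = 1 \<and> (\<forall>X\<in>tangent_space \<A> F p. orthogonal (N p) X))"

(* H is defined by (mean curvature vector) = -H N, whence the sign; scalar A(X,Y) has no sign. *)
definition mean_curvature ::
  "('a::euclidean_space, 'm) atlas \<Rightarrow> ('m \<Rightarrow> 'b::euclidean_space) \<Rightarrow> ('m \<Rightarrow> 'b) \<Rightarrow> 'm \<Rightarrow> real" where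
  "mean_curvature \<A> F N p = - (mean_curvature_vector \<A> F p \<bullet> N p)"

definition scalar_sff ::
  "('a::euclidean_space, 'm) atlas \<Rightarrow> ('m \<Rightarrow> 'b::euclidean_space) \<Rightarrow> ('m \<Rightarrow> 'b) \<Rightarrow>
     'm \<Rightarrow> 'b \<Rightarrow> 'b \<Rightarrow> real" where
  "scalar_sff \<A> F N p X Y = second_fundamental_form \<A> F p X Y \<bullet> N p"

definition self_expander ::
  "('a::euclidean_space, 'm) atlas \<Rightarrow> ('m \<Rightarrow> 'b::euclidean_space) \<Rightarrow> bool" where
  "self_expander \<A> F \<longleftrightarrow>
     (\<forall>p. mean_curvature_vector \<A> F p = (1/2) *\<^sub>R normal_part \<A> F p (F p))"

section \<open>Completeness of the induced metric\<close>

(* The distance of the metric induced by an immersion F: infimum of the lengths of piecewise C^1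
   curves.  As F is locally an embedding, a continuous curve \<gamma> in the manifold is piecewise C^1 iff
   F o \<gamma> is.  The library's piecewise C^1 allows the derivative to be unbounded near
   the exceptional points, so has_integral is what restricts to curves of finite length. *)
definition induced_dist :: "('m::topological_space \<Rightarrow> 'b::euclidean_space) \<Rightarrow> 'm \<Rightarrow> 'm \<Rightarrow> real" where
  "induced_dist F p q =
     Inf {l. \<exists>\<gamma>. path \<gamma> \<and> pathstart \<gamma> = p \<and> pathfinish \<gamma> = q \<and>
                (F \<circ> \<gamma>) piecewise_C1_differentiable_on {0..1} \<and>
                ((\<lambda>t. norm (vector_derivative (F \<circ> \<gamma>) (at t))) has_integral l) {0..1}}"

definition complete_immersion :: "('m::topological_space \<Rightarrow> 'b::euclidean_space) \<Rightarrow> bool" where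
  "complete_immersion F \<longleftrightarrow> Metric_space.mcomplete UNIV (induced_dist F)"

end

theory Submission
  imports Defs
begin

text \<open>
  Why the theorem holds. On a self-expander the mean curvature is \<open>H = - \<langle>x, n\<rangle> / 2\<close>. Two classical
  identities follow from this formula and the Codazzi equation, namely
  \<open>\<Delta>H + \<langle>x\<^sup>T, \<nabla>H\<rangle> / 2 = - (|A|\<^sup>2 + 1/2) H\<close> and \<open>\<Delta>|x|\<^sup>2 = 2n + 4H\<^sup>2\<close>. Since
  \<open>\<langle>x\<^sup>T, \<nabla>H\<rangle> = A(x\<^sup>T, x\<^sup>T) / 2\<close>, the curvature hypothesis says exactly that \<open>H\<close> is superharmonic for the drift
  Laplacian \<open>L = \<Delta> - (\<alpha>/2) \<langle>x\<^sup>T, \<nabla> \<cdot>\<rangle>\<close>. On the other hand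
  \<open>L|x|\<^sup>2 = 2n + 4(1 + \<alpha>)H\<^sup>2 - \<alpha>|x|\<^sup>2\<close>, and the growth bound on \<open>H\<close> together with the choice of \<open>\<alpha>\<close>
  makes this negative far from the origin. So \<open>|x|\<^sup>2\<close> is a proper function that is strictly superharmonic
  outside a compact set; comparing \<open>H\<close> with \<open>H + \<epsilon>|x|\<^sup>2\<close> shows that \<open>H\<close>, being bounded below, attains its
  minimum (\<open>H_attains_min\<close>). The strong minimum principle makes \<open>H\<close> constant, and the equation for
  \<open>\<Delta>H\<close> then forces \<open>H = 0\<close>.

  Consequently the position vector is tangential everywhere. The normal is then constant along the
  position field, and \<open>|x|\<^sup>2\<close> has critical points only over the origin. A function that is constant along
  the position field is therefore bounded by its values over the origin: at a maximum point of its
  difference with \<open>\<epsilon>|x|\<^sup>2\<close> the radial derivative gives \<open>x = 0\<close>. The preimage of the origin is finite,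
  and applying this to a product of squared distances from the corresponding normals shows that the normal
  takes only finitely many values, hence just one (\<open>normal_constant\<close>). The immersion is now a
  proper local homeomorphism from a connected space into a hyperplane, and such a map is a bijection because
  Euclidean space is simply connected (\<open>proper_local_homeomorphism_bij\<close>).

  All differential geometry is done in a single chart, with directional derivatives in place of connections.
  The Laplacian at a point is written with the preimages \<open>e\<^sub>b\<close> of an orthonormal frame \<open>b\<close> of the tangent space,
  as \<open>\<Sum>\<^sub>b D\<^sup>2g(e\<^sub>b, e\<^sub>b) - Dg((D\<^sup>2f(e\<^sub>b, e\<^sub>b))\<^sup>T)\<close>, the last vector being pulled back to the parameter
  domain; no Christoffel symbols or derivatives of the metric are needed.
\<close>

section \<open>Directional derivatives of smooth maps\<close>

definition dird :: "('a::euclidean_space \<Rightarrow> 'b::euclidean_space) \<Rightarrow> 'a \<Rightarrow> 'a \<Rightarrow> 'b" where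
  "dird f v x = frechet_derivative f (at x) v"

text \<open>Smoothness is used only through the next three facts: a smooth map has a directional derivative,
  which is again smooth, and it is continuous.\<close>

lemma smooth_on_has_derivative:
  assumes "smooth_on f S" "x \<in> S"
  shows "(f has_derivative (\<lambda>v. dird f v x)) (at x)"
proof -
  have "Ck_on (Suc 0) f S" using assms(1) unfolding smooth_on_def by blast
  then have "f differentiable (at x)" using assms(2) by simp
  then show ?thesis
    unfolding dird_def by (simp add: frechet_derivative_works[symmetric])
qed

lemma smooth_on_dird:
  assumes "smooth_on f S"
  shows "smooth_on (dird f v) S"
  unfolding smooth_on_def
proof
  fix k
  have "Ck_on (Suc k) f S" using assms unfolding smooth_on_def by blast
  then have "Ck_on k (\<lambda>x. frechet_derivative f (at x) v) S" by simp
  then show "Ck_on k (dird f v) S" by (simp add: dird_def[abs_def])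
qed

lemma smooth_on_isCont:
  assumes "smooth_on f S" "x \<in> S"
  shows "isCont f x"
  using has_derivative_continuous[OF smooth_on_has_derivative[OF assms]] .

lemma dird_eqI:
  assumes "(f has_derivative f') (at x)"
  shows "dird f v x = f' v"
  using frechet_derivative_at[OF assms] by (simp add: dird_def)

lemma linear_dird:
  assumes "smooth_on f S" "x \<in> S"
  shows "linear (\<lambda>v. dird f v x)"
  using has_derivative_linear[OF smooth_on_has_derivative[OF assms]] .

text \<open>The mean value theorem, applied once in each direction, turns the second difference over a
  parallelogram into one value of the mixed derivative. The second difference is symmetric in the two
  directions, so letting the parallelogram shrink identifies the two mixed derivatives.\<close>

lemma mixed_difference_mean_value:
  fixes g :: "'a::euclidean_space \<Rightarrow> real"
  assumes g: "\<And>y. y \<in> S \<Longrightarrow> (g has_derivative g' y) (at y)"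
    and g': "\<And>y. y \<in> S \<Longrightarrow> ((\<lambda>y. g' y v) has_derivative g'' y) (at y)"
    and s: "s > 0"
    and S: "\<And>p q. 0 \<le> p \<Longrightarrow> p \<le> s \<Longrightarrow> 0 \<le> q \<Longrightarrow> q \<le> s \<Longrightarrow> x + p *\<^sub>R v + q *\<^sub>R w \<in> S"
  shows "\<exists>p q. 0 < p \<and> p < s \<and> 0 < q \<and> q < s \<and>
    g (x + s *\<^sub>R v + s *\<^sub>R w) - g (x + s *\<^sub>R v) - g (x + s *\<^sub>R w) + g x
      = s^2 * g'' (x + p *\<^sub>R v + q *\<^sub>R w) w"
proof -
  define \<phi> where "\<phi> p = g (x + p *\<^sub>R v + s *\<^sub>R w) - g (x + p *\<^sub>R v)" for p
  define \<phi>' where "\<phi>' p = g' (x + p *\<^sub>R v + s *\<^sub>R w) v - g' (x + p *\<^sub>R v) v" for p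
  have lin: "g' y (c *\<^sub>R u) = c * g' y u" if "y \<in> S" for y c u
    using has_derivative_linear[OF g[OF that]] by (simp add: linear_scale)
  have lin2: "g'' y (c *\<^sub>R u) = c * g'' y u" if "y \<in> S" for y c u
    using has_derivative_linear[OF g'[OF that]] by (simp add: linear_scale)
  have d1: "((\<lambda>p. g (x + p *\<^sub>R v + q *\<^sub>R w)) has_real_derivative g' (x + p *\<^sub>R v + q *\<^sub>R w) v) (at p)"
    if "0 \<le> p" "p \<le> s" "0 \<le> q" "q \<le> s" for p q
  proof -
    have "((\<lambda>p. g (x + p *\<^sub>R v + q *\<^sub>R w)) has_derivative (\<lambda>h. g' (x + p *\<^sub>R v + q *\<^sub>R w) (h *\<^sub>R v))) (at p)"
      by (rule has_derivative_compose[where f = "\<lambda>p. x + p *\<^sub>R v + q *\<^sub>R w" and g = g, OF _ g[OF S[OF that]]]) (use that in \<open>auto intro!: derivative_eq_intros\<close>)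
    then show ?thesis
      using lin[OF S[OF that]] by (simp add: has_field_derivative_def mult_commute_abs)
  qed
  have d2: "((\<lambda>q. g' (x + p *\<^sub>R v + q *\<^sub>R w) v) has_real_derivative g'' (x + p *\<^sub>R v + q *\<^sub>R w) w) (at q)"
    if "0 \<le> p" "p \<le> s" "0 \<le> q" "q \<le> s" for p q
  proof -
    have "((\<lambda>q. g' (x + p *\<^sub>R v + q *\<^sub>R w) v) has_derivative (\<lambda>h. g'' (x + p *\<^sub>R v + q *\<^sub>R w) (h *\<^sub>R w))) (at q)"
      by (rule has_derivative_compose[where f = "\<lambda>q. x + p *\<^sub>R v + q *\<^sub>R w" and g = "\<lambda>y. g' y v", OF _ g'[OF S[OF that]]]) (use that in \<open>auto intro!: derivative_eq_intros\<close>)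
    then show ?thesis
      using lin2[OF S[OF that]] by (simp add: has_field_derivative_def mult_commute_abs)
  qed
  have "\<exists>p>0. p < s \<and> \<phi> s - \<phi> 0 = (s - 0) * \<phi>' p"
  proof (rule MVT2[OF s])
    fix p assume "0 \<le> p" "p \<le> s"
    then show "(\<phi> has_real_derivative \<phi>' p) (at p)"
      unfolding \<phi>_def[abs_def] \<phi>'_def
      using d1[of p s] d1[of p 0] s by (intro DERIV_diff) auto
  qed
  then obtain p where p: "0 < p" "p < s" "\<phi> s - \<phi> 0 = s * \<phi>' p" by auto
  have "\<exists>q>0. q < s \<and> g' (x + p *\<^sub>R v + s *\<^sub>R w) v - g' (x + p *\<^sub>R v + 0 *\<^sub>R w) v
      = (s - 0) * g'' (x + p *\<^sub>R v + q *\<^sub>R w) w"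
    by (rule MVT2[OF s, where f = "\<lambda>q. g' (x + p *\<^sub>R v + q *\<^sub>R w) v"]) (use d2 p in auto)
  then obtain q where q: "0 < q" "q < s" "\<phi>' p = s * g'' (x + p *\<^sub>R v + q *\<^sub>R w) w"
    by (auto simp: \<phi>'_def)
  have "\<phi> s - \<phi> 0 = s^2 * g'' (x + p *\<^sub>R v + q *\<^sub>R w) w"
    using p(3) q(3) by (simp add: power2_eq_square)
  then show ?thesis using p q by (intro exI[of _ p] exI[of _ q]) (simp add: \<phi>_def)
qed

lemma mixed_derivatives_commute_real:
  fixes g :: "'a::euclidean_space \<Rightarrow> real"
  assumes "open S" "x \<in> S"
    and g: "\<And>y. y \<in> S \<Longrightarrow> (g has_derivative g' y) (at y)"
    and g2: "\<And>y u. y \<in> S \<Longrightarrow> ((\<lambda>y. g' y u) has_derivative g'' y u) (at y)"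
    and cont: "\<And>u w. isCont (\<lambda>y. g'' y u w) x"
  shows "g'' x v w = g'' x w v"
proof (rule ccontr)
  assume ne: "g'' x v w \<noteq> g'' x w v"
  define \<epsilon> where "\<epsilon> = \<bar>g'' x v w - g'' x w v\<bar> / 2"
  have "\<epsilon> > 0" using ne by (simp add: \<epsilon>_def)
  have lim: "((\<lambda>y. g'' y u w) \<longlongrightarrow> g'' x u w) (nhds x)" for u w
    using cont[of u w] tendsto_at_iff_tendsto_nhds[of "\<lambda>y. g'' y u w" x] by (simp add: isCont_def)
  have "\<forall>\<^sub>F y in nhds x. y \<in> S \<and> dist (g'' y v w) (g'' x v w) < \<epsilon> \<and> dist (g'' y w v) (g'' x w v) < \<epsilon>"
    by (intro eventually_conj eventually_nhds_in_open tendstoD lim assms(1,2) \<open>\<epsilon> > 0\<close>)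
  then obtain d where d: "d > 0"
    and dS: "\<And>y. dist y x < d \<Longrightarrow> y \<in> S \<and> dist (g'' y v w) (g'' x v w) < \<epsilon> \<and> dist (g'' y w v) (g'' x w v) < \<epsilon>"
    unfolding eventually_nhds_metric by blast
  define s where "s = d / (2 * (norm v + norm w + 1))"
  have s: "s > 0" using d by (simp add: s_def add_nonneg_pos)
  have near: "dist (x + p *\<^sub>R v + q *\<^sub>R w) x < d" if "0 \<le> p" "p \<le> s" "0 \<le> q" "q \<le> s" for p q
  proof -
    have "dist (x + p *\<^sub>R v + q *\<^sub>R w) x = norm (p *\<^sub>R v + q *\<^sub>R w)"
      by (simp add: dist_norm algebra_simps)
    also have "\<dots> \<le> p * norm v + q * norm w"
      by (rule order_trans[OF norm_triangle_ineq]) (use that in simp)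
    also have "\<dots> \<le> s * norm v + s * norm w"
      using that by (intro add_mono mult_right_mono) auto
    also have "\<dots> < s * (2 * (norm v + norm w + 1))"
    proof -
      have "0 \<le> s * norm v" "0 \<le> s * norm w" using s by auto
      then have "s * norm v + s * norm w < 2 * (s * norm v) + 2 * (s * norm w) + 2 * s"
        using s by linarith
      then show ?thesis by (simp add: algebra_simps)
    qed
    also have "\<dots> = d"
      using add_nonneg_pos[of "norm v + norm w" 1] by (simp add: s_def)
    finally show ?thesis .
  qed
  have near': "dist (x + p *\<^sub>R w + q *\<^sub>R v) x < d" if "0 \<le> p" "p \<le> s" "0 \<le> q" "q \<le> s" for p q
    using near[OF that(3,4,1,2)] by (simp add: add.commute add.left_commute)
  obtain p q where 1: "0 < p" "p < s" "0 < q" "q < s"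
    "g (x + s *\<^sub>R v + s *\<^sub>R w) - g (x + s *\<^sub>R v) - g (x + s *\<^sub>R w) + g x
      = s^2 * g'' (x + p *\<^sub>R v + q *\<^sub>R w) v w"
    using mixed_difference_mean_value[where g=g and g'=g' and g''="\<lambda>y. g'' y v" and S=S and x=x and v=v and w=w,
        OF g g2 s] near dS by blast
  obtain p' q' where 2: "0 < p'" "p' < s" "0 < q'" "q' < s"
    "g (x + s *\<^sub>R w + s *\<^sub>R v) - g (x + s *\<^sub>R w) - g (x + s *\<^sub>R v) + g x
      = s^2 * g'' (x + p' *\<^sub>R w + q' *\<^sub>R v) w v"
    using mixed_difference_mean_value[where g=g and g'=g' and g''="\<lambda>y. g'' y w" and S=S and x=x and v=w and w=v,
        OF g g2 s] near' dS by blast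
  have sw: "x + s *\<^sub>R w + s *\<^sub>R v = x + s *\<^sub>R v + s *\<^sub>R w" by simp
  have "s^2 * g'' (x + p *\<^sub>R v + q *\<^sub>R w) v w = s^2 * g'' (x + p' *\<^sub>R w + q' *\<^sub>R v) w v"
    using 1(5) 2(5)[unfolded sw] by linarith
  then have eq: "g'' (x + p *\<^sub>R v + q *\<^sub>R w) v w = g'' (x + p' *\<^sub>R w + q' *\<^sub>R v) w v"
    using s by simp
  have "dist (g'' (x + p *\<^sub>R v + q *\<^sub>R w) v w) (g'' x v w) < \<epsilon>"
    using dS[OF near[of p q]] 1 by simp
  moreover have "dist (g'' (x + p' *\<^sub>R w + q' *\<^sub>R v) w v) (g'' x w v) < \<epsilon>"
    using dS[OF near'[of p' q']] 2 by simp
  ultimately show False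
    using eq unfolding \<epsilon>_def dist_real_def by (smt (verit) field_sum_of_halves)
qed

lemma dird_commute:
  fixes f :: "'a::euclidean_space \<Rightarrow> 'b::euclidean_space"
  assumes f: "smooth_on f S" and S: "open S" "x \<in> S"
  shows "dird (dird f v) w x = dird (dird f w) v x"
proof (rule euclidean_eqI)
  fix b :: 'b
  show "dird (dird f v) w x \<bullet> b = dird (dird f w) v x \<bullet> b"
  proof (rule mixed_derivatives_commute_real[OF S, where g = "\<lambda>x. f x \<bullet> b"
        and g' = "\<lambda>x v. dird f v x \<bullet> b" and g''="\<lambda>x v w. dird (dird f v) w x \<bullet> b"])
    show "((\<lambda>x. f x \<bullet> b) has_derivative (\<lambda>v. dird f v y \<bullet> b)) (at y)" if "y \<in> S" for y
      by (intro has_derivative_inner_left smooth_on_has_derivative[OF f that])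
    show "((\<lambda>y. dird f u y \<bullet> b) has_derivative (\<lambda>w. dird (dird f u) w y \<bullet> b)) (at y)" if "y \<in> S" for y u
      by (intro has_derivative_inner_left smooth_on_has_derivative[OF smooth_on_dird[OF f] that])
    show "isCont (\<lambda>y. dird (dird f u) w y \<bullet> b) x" for u w
      using smooth_on_isCont[OF smooth_on_dird[OF smooth_on_dird[OF f]] S(2)] by (intro continuous_intros)
  qed
qed

lemma linear_dird_dird:
  assumes "smooth_on f S" "open S" "x \<in> S"
  shows "linear (\<lambda>v. dird (dird f v) w x)"
proof -
  have "(\<lambda>v. dird (dird f v) w x) = (\<lambda>v. dird (dird f w) v x)"
    using dird_commute[OF assms] by auto
  then show ?thesis using linear_dird[OF smooth_on_dird[OF assms(1)] assms(3)] by simp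
qed

text \<open>The product rule needs no differentiability of a factor whose cofactor vanishes at the point; continuity
  is enough.\<close>

lemma has_derivative_scaleR_vanishing:
  fixes k :: "'a::euclidean_space \<Rightarrow> 'b::euclidean_space"
  assumes g: "isCont g a" and k: "(k has_derivative k') (at a)" and k0: "k a = 0"
  shows "((\<lambda>x. g x *\<^sub>R k x) has_derivative (\<lambda>v. g a *\<^sub>R k' v)) (at a)"
proof -
  have bl: "bounded_linear k'" using k by (rule has_derivative_bounded_linear)
  then obtain K where K: "K > 0" "\<And>v. norm (k' v) \<le> norm v * K"
    using bounded_linear.pos_bounded by blast
  let ?q = "\<lambda>y. (k y - k a - k' (y - a)) /\<^sub>R norm (y - a)"
  have q: "(?q \<longlongrightarrow> 0) (at a)"
    using k unfolding has_derivative_at_within by simp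
  have g1: "(g \<longlongrightarrow> g a) (at a)" using g by (simp add: isCont_def)
  have 1: "((\<lambda>y. g y *\<^sub>R ?q y) \<longlongrightarrow> 0) (at a)"
    using tendsto_scaleR[OF g1 q] by simp
  have 2: "((\<lambda>y. (g y - g a) *\<^sub>R (k' (y - a) /\<^sub>R norm (y - a))) \<longlongrightarrow> 0) (at a)"
  proof (rule tendsto_0_le[where K = K])
    show "((\<lambda>y. g y - g a) \<longlongrightarrow> 0) (at a)" using g1 by (simp add: LIM_zero)
    show "\<forall>\<^sub>F y in at a. norm ((g y - g a) *\<^sub>R (k' (y - a) /\<^sub>R norm (y - a))) \<le> norm (g y - g a) * K"
    proof (rule always_eventually, rule allI)
      fix y
      have "norm (k' (y - a) /\<^sub>R norm (y - a)) \<le> K"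
        using K(2)[of "y - a"] K(1) by (cases "y = a") (auto simp: divide_simps mult.commute)
      then show "norm ((g y - g a) *\<^sub>R (k' (y - a) /\<^sub>R norm (y - a))) \<le> norm (g y - g a) * K"
        by (simp only: norm_scaleR real_norm_def[symmetric] mult_left_mono norm_ge_zero)
    qed
  qed
  have "((\<lambda>y. (g y *\<^sub>R k y - g a *\<^sub>R k a - g a *\<^sub>R k' (y - a)) /\<^sub>R norm (y - a)) \<longlongrightarrow> 0) (at a)"
    using tendsto_add[OF 1 2] k0 by (simp add: algebra_simps)
  then show ?thesis
    unfolding has_derivative_at_within
    using bounded_linear_scaleR_right[THEN bounded_linear_compose, OF bl, of "g a"] by simp
qed

lemma norm_linear_le_sum_Basis:
  fixes L :: "'a::euclidean_space \<Rightarrow> 'b::real_normed_vector"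
  assumes "linear L"
  shows "norm (L v) \<le> (\<Sum>i\<in>Basis. norm (L i)) * norm v"
proof -
  have "L v = (\<Sum>i\<in>Basis. (v \<bullet> i) *\<^sub>R L i)"
    by (subst euclidean_representation[symmetric, of v])
       (simp add: linear_sum[OF assms] linear_scale[OF assms])
  also have "norm \<dots> \<le> (\<Sum>i\<in>Basis. norm (L i) * norm v)"
    by (rule sum_norm_le) (simp add: mult.commute[of "norm (L _)"] mult_right_mono Basis_le_norm)
  finally show ?thesis by (simp add: sum_distrib_right)
qed

text \<open>Solutions of a linear system inherit differentiability from its coefficients. Writing the
  equation as \<open>s = J y - (J A - id) s\<close>, boundedness of \<open>s\<close> near \<open>a\<close> gives continuity, and continuity
  gives the derivative because \<open>J A - id\<close> vanishes at \<open>a\<close>.\<close>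

lemma has_derivative_linear_system_solution:
  fixes A :: "'c::euclidean_space \<Rightarrow> 'a::euclidean_space \<Rightarrow> 'b::euclidean_space"
  assumes S: "open S" "a \<in> S"
    and lin: "\<And>x. x \<in> S \<Longrightarrow> linear (A x)"
    and A': "\<And>v. ((\<lambda>x. A x v) has_derivative A' v) (at a)"
    and y: "(y has_derivative y') (at a)"
    and sol: "\<And>x. x \<in> S \<Longrightarrow> A x (s x) = y x"
    and J: "linear J" "\<And>v. J (A a v) = v"
  shows "(s has_derivative (\<lambda>w. J (y' w) - (\<Sum>i\<in>Basis. (s a \<bullet> i) *\<^sub>R J (A' i w)))) (at a)"
proof -
  have blJ: "bounded_linear J" using J(1) by (simp add: linear_conv_bounded_linear)
  define k where "k v x = J (A x v) - v" for v x
  have k': "(k v has_derivative (\<lambda>w. J (A' v w))) (at a)" for v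
    unfolding k_def[abs_def]
    by (rule derivative_eq_intros bounded_linear.has_derivative[OF blJ] A' refl | simp)+
  have k0: "k v a = 0" for v by (simp add: k_def J)
  have klin: "linear (\<lambda>v. k v x)" if "x \<in> S" for x
    unfolding k_def using linear_compose[OF lin[OF that] J(1)]
    by (intro linear_compose_sub linear_ident) (simp add: o_def)
  have Jy': "((\<lambda>x. J (y x)) has_derivative (\<lambda>w. J (y' w))) (at a)"
    by (rule bounded_linear.has_derivative[OF blJ y])
  have eq: "s x = J (y x) - k (s x) x" if "x \<in> S" for x
    using sol[OF that] by (simp add: k_def)
  have eq2: "s x = J (y x) - (\<Sum>i\<in>Basis. (s x \<bullet> i) *\<^sub>R k i x)" if "x \<in> S" for x
  proof -
    have "k (s x) x = (\<Sum>i\<in>Basis. (s x \<bullet> i) *\<^sub>R k i x)"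
      by (subst euclidean_representation[symmetric, of "s x"])
         (simp add: linear_sum[OF klin[OF that]] linear_scale[OF klin[OF that]])
    then show ?thesis using eq[OF that] by simp
  qed
  define \<kappa> where "\<kappa> x = (\<Sum>i\<in>Basis. norm (k i x))" for x
  have kc: "isCont (k v) a" for v using has_derivative_continuous[OF k'] .
  have \<kappa>: "(\<kappa> \<longlongrightarrow> 0) (at a)"
  proof -
    have "isCont \<kappa> a" unfolding \<kappa>_def[abs_def] by (intro continuous_intros kc)
    then show ?thesis by (simp add: isCont_def \<kappa>_def k0)
  qed
  have kle: "norm (k v x) \<le> \<kappa> x * norm v" if "x \<in> S" for v x
    unfolding \<kappa>_def using norm_linear_le_sum_Basis[OF klin[OF that]] .
  have Jyc: "((\<lambda>x. J (y x)) \<longlongrightarrow> J (y a)) (at a)"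
    using has_derivative_continuous[OF Jy'] by (simp add: isCont_def)
  have evS: "\<forall>\<^sub>F x in at a. x \<in> S"
    using S by (intro eventually_at_in_open') auto
  have bound: "\<forall>\<^sub>F x in at a. norm (s x - J (y x)) \<le> norm (\<kappa> x) * (2 * (norm (J (y a)) + 1))"
  proof -
    have e1: "\<forall>\<^sub>F x in at a. \<kappa> x < 1 / 2" using order_tendstoD(2)[OF \<kappa>, of "1/2"] by simp
    have e2: "\<forall>\<^sub>F x in at a. norm (J (y x)) < norm (J (y a)) + 1"
      using order_tendstoD(2)[OF tendsto_norm[OF Jyc]] by simp
    show ?thesis using e1 e2 evS
    proof eventually_elim
      case (elim x)
      have \<kappa>0: "\<kappa> x \<ge> 0" by (simp add: \<kappa>_def sum_nonneg)
      have "norm (s x) \<le> norm (J (y x)) + norm (k (s x) x)"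
        by (subst eq[OF elim(3)]) (rule norm_triangle_ineq4)
      also have "norm (k (s x) x) \<le> \<kappa> x * norm (s x)" by (rule kle[OF elim(3)])
      also have "\<dots> \<le> 1/2 * norm (s x)" using elim(1) by (intro mult_right_mono) auto
      finally have sle: "norm (s x) \<le> 2 * (norm (J (y a)) + 1)" using elim(2) by simp
      have "norm (s x - J (y x)) = norm (k (s x) x)"
        using eq[OF elim(3)] by (metis add_diff_cancel_left' diff_add_cancel norm_minus_commute)
      also have "\<dots> \<le> \<kappa> x * norm (s x)" by (rule kle[OF elim(3)])
      also have "\<dots> \<le> \<kappa> x * (2 * (norm (J (y a)) + 1))" by (intro mult_left_mono sle \<kappa>0)
      finally show ?case using \<kappa>0 by simp
    qed
  qed
  have "((\<lambda>x. s x - J (y x)) \<longlongrightarrow> 0) (at a)"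
    by (rule tendsto_0_le[OF \<kappa> bound])
  from tendsto_add[OF this Jyc] have "(s \<longlongrightarrow> J (y a)) (at a)" by simp
  moreover have "s a = J (y a)" using eq[OF S(2)] k0[of "s a"] by simp
  ultimately have sc: "isCont s a" by (simp add: isCont_def)
  have "((\<lambda>x. J (y x) - (\<Sum>i\<in>Basis. (s x \<bullet> i) *\<^sub>R k i x)) has_derivative
      (\<lambda>w. J (y' w) - (\<Sum>i\<in>Basis. (s a \<bullet> i) *\<^sub>R J (A' i w)))) (at a)"
    by (intro has_derivative_diff has_derivative_sum Jy' has_derivative_scaleR_vanishing k' k0
        continuous_intros sc)
  then show ?thesis
    by (rule has_derivative_transform_within_open[OF _ S]) (use eq2 in auto)
qed

text \<open>Both tests reduce to one variable by restricting to the line through the minimum with direction \<open>v\<close>.\<close>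

lemma local_min_derivative_tests:
  fixes \<phi> :: "'a::euclidean_space \<Rightarrow> real"
  assumes S: "open S" "x \<in> S"
    and d1: "\<And>y. y \<in> S \<Longrightarrow> (\<phi> has_derivative \<phi>' y) (at y)"
    and d2: "((\<lambda>y. \<phi>' y v) has_derivative \<phi>'') (at x)"
    and min: "\<And>y. y \<in> S \<Longrightarrow> \<phi> x \<le> \<phi> y"
  shows "\<phi>' x v = 0" "0 \<le> \<phi>'' v"
proof -
  obtain r where r: "r > 0" "ball x r \<subseteq> S" using S openE by blast
  define \<delta> where "\<delta> = r / (norm v + 1)"
  have \<delta>: "\<delta> > 0" using r by (simp add: \<delta>_def add_nonneg_pos)
  have inS: "x + t *\<^sub>R v \<in> S" if "\<bar>t\<bar> < \<delta>" for t
  proof -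
    have "\<bar>t\<bar> * norm v \<le> \<bar>t\<bar> * (norm v + 1)" by (intro mult_left_mono) auto
    also have "\<dots> < r" using that by (simp add: \<delta>_def pos_less_divide_eq add_nonneg_pos)
    finally show ?thesis using r by (auto simp: dist_norm)
  qed
  have g1: "((\<lambda>t. \<phi> (x + t *\<^sub>R v)) has_real_derivative \<phi>' (x + t *\<^sub>R v) v) (at t)" if "\<bar>t\<bar> < \<delta>" for t
  proof -
    have "((\<lambda>t. \<phi> (x + t *\<^sub>R v)) has_derivative (\<lambda>h. \<phi>' (x + t *\<^sub>R v) (h *\<^sub>R v))) (at t)"
      by (rule has_derivative_compose[where f = "\<lambda>t. x + t *\<^sub>R v" and g = \<phi>, OF _ d1[OF inS[OF that]]]) (auto intro!: derivative_eq_intros)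
    then show ?thesis
      using has_derivative_linear[OF d1[OF inS[OF that]]]
      by (simp add: has_field_derivative_def linear_scale mult_commute_abs)
  qed
  have "((\<lambda>t. \<phi>' (x + t *\<^sub>R v) v) has_derivative (\<lambda>h. \<phi>'' (h *\<^sub>R v))) (at 0)"
    by (rule has_derivative_compose[of "\<lambda>t. x + t *\<^sub>R v" "\<lambda>h. h *\<^sub>R v" 0 UNIV "\<lambda>y. \<phi>' y v"])
       (use d2 in \<open>auto intro!: derivative_eq_intros\<close>)
  then have g2: "((\<lambda>t. \<phi>' (x + t *\<^sub>R v) v) has_real_derivative \<phi>'' v) (at 0)"
    using has_derivative_linear[OF d2]
    by (simp add: has_field_derivative_def linear_scale mult_commute_abs)
  show 0: "\<phi>' x v = 0"
    using DERIV_local_min[OF g1[of 0] \<delta>] min inS \<delta> by simp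
  show "0 \<le> \<phi>'' v"
  proof (rule ccontr)
    assume "\<not> 0 \<le> \<phi>'' v"
    then obtain d where d: "d > 0" "\<And>h. 0 < h \<Longrightarrow> h < d \<Longrightarrow> \<phi>' (x + h *\<^sub>R v) v < 0"
      using DERIV_neg_dec_right[OF g2] 0 by auto
    define t where "t = min d \<delta> / 2"
    have t: "0 < t" "t < d" "t < \<delta>" using d(1) \<delta> by (auto simp: t_def)
    have "\<exists>z>0. z < t \<and> \<phi> (x + t *\<^sub>R v) - \<phi> (x + 0 *\<^sub>R v) = (t - 0) * \<phi>' (x + z *\<^sub>R v) v"
      by (rule MVT2[OF t(1), where f="\<lambda>t. \<phi> (x + t *\<^sub>R v)"]) (use g1 t in auto)
    then obtain z where z: "0 < z" "z < t" "\<phi> (x + t *\<^sub>R v) - \<phi> x = t * \<phi>' (x + z *\<^sub>R v) v" by auto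
    have "\<phi>' (x + z *\<^sub>R v) v < 0" using d(2)[of z] z t by auto
    then have "\<phi> (x + t *\<^sub>R v) - \<phi> x < 0" using z t by (simp add: mult_pos_neg)
    then show False using min[OF inS[of t]] t by simp
  qed
qed


section \<open>The strong minimum principle\<close>

text \<open>The barrier of the Hopf argument: for large \<open>k\<close> the quadratic term in \<open>k\<close> of its second derivatives
  dominates, which makes it a strict subsolution away from \<open>c\<close>.\<close>

lemma gaussian_derivatives:
  fixes c :: "'a::euclidean_space" and k :: real
  defines "G \<equiv> \<lambda>x. exp (- k * ((x - c) \<bullet> (x - c)))"
  shows "(G has_derivative (\<lambda>v. - 2 * k * ((x - c) \<bullet> v) * G x)) (at x)"
    and "((\<lambda>x. - 2 * k * ((x - c) \<bullet> v) * G x) has_derivative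
      (\<lambda>u. G x * (4 * k^2 * ((x - c) \<bullet> v) * ((x - c) \<bullet> u) - 2 * k * (u \<bullet> v)))) (at x)"
proof -
  show 1: "(G has_derivative (\<lambda>v. - 2 * k * ((x - c) \<bullet> v) * G x)) (at x)" for x
    unfolding G_def
    by (rule derivative_eq_intros refl | simp add: fun_eq_iff inner_commute algebra_simps)+
  show "((\<lambda>x. - 2 * k * ((x - c) \<bullet> v) * G x) has_derivative
      (\<lambda>u. G x * (4 * k^2 * ((x - c) \<bullet> v) * ((x - c) \<bullet> u) - 2 * k * (u \<bullet> v)))) (at x)"
    by (rule derivative_eq_intros 1 refl | simp add: fun_eq_iff algebra_simps power2_eq_square)+
qed

text \<open>The ball of half the radius around the midpoint of \<open>y\<close> and \<open>z\<close> touches the sphere of radius \<open>dist y z\<close>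
  around \<open>y\<close> from inside, in \<open>z\<close> alone. This is the parallelogram law.\<close>

lemma unique_point_of_internally_tangent_ball:
  fixes y z x :: "'a::real_inner"
  assumes far: "dist y z \<le> dist y x" and x: "dist (midpoint y z) x \<le> dist y z / 2"
  shows "x = z"
proof -
  define p where "p = x - midpoint y z"
  define q where "q = z - midpoint y z"
  have q: "norm q = dist y z / 2"
    by (simp add: q_def dist_norm[symmetric] dist_midpoint)
  have p: "norm p \<le> norm q" using x q by (simp add: p_def dist_norm norm_minus_commute)
  have pq: "p + q = x - y"
    by (simp add: p_def q_def midpoint_def algebra_simps flip: scaleR_add_left)
  have "2 * norm q \<le> norm (p + q)"
    using far q by (simp add: pq dist_norm norm_minus_commute)
  then have "(2 * norm q)^2 \<le> (norm (p + q))^2" by (intro power_mono) auto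
  moreover have "(norm p)^2 \<le> (norm q)^2" using p by (intro power_mono) auto
  moreover have "(norm (p - q))^2 + (norm (p + q))^2 = 2 * (norm p)^2 + 2 * (norm q)^2"
    by (simp add: power2_norm_eq_inner inner_add_left inner_add_right inner_diff_left inner_diff_right
        inner_commute)
  moreover have "(2 * norm q)^2 = 4 * (norm q)^2" by (simp add: power_mult_distrib)
  ultimately have "(norm (p - q))^2 \<le> 0" by linarith
  then have "p = q" by simp
  then show ?thesis by (simp add: p_def q_def)
qed

text \<open>Hopf's argument. The operator has no zeroth order term; its principal part is given as a sum of squares of
  the vectors \<open>e x i\<close>, which may depend on \<open>x\<close> arbitrarily as long as they are locally bounded and locally uniformly
  elliptic. If the minimum set were not open, a ball outside it would touch it in a single point \<open>z\<close>. Near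
  \<open>z\<close> a small multiple of a Gaussian barrier centred at the middle of this ball can be subtracted so
  that the minimum over a small ball around \<open>z\<close> stays in the interior; there the operator is both
  nonnegative and negative.\<close>

theorem strong_minimum_principle:
  fixes \<phi> :: "'a::euclidean_space \<Rightarrow> real" and e :: "'a \<Rightarrow> 'i \<Rightarrow> 'a"
  assumes V: "open V"
    and d1: "\<And>x. x \<in> V \<Longrightarrow> (\<phi> has_derivative \<phi>' x) (at x)"
    and d2: "\<And>x v. x \<in> V \<Longrightarrow> ((\<lambda>y. \<phi>' y v) has_derivative \<phi>'' x v) (at x)"
    and super: "\<And>x. x \<in> V \<Longrightarrow> (\<Sum>i\<in>I x. \<phi>'' x (e x i) (e x i)) + \<phi>' x (\<beta> x) \<le> 0"
    and elliptic: "\<And>x0. x0 \<in> V \<Longrightarrow> \<exists>r>0. \<exists>l>0. \<exists>C. \<forall>x\<in>V \<inter> ball x0 r.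
        (\<forall>y. l * (norm y)^2 \<le> (\<Sum>i\<in>I x. (y \<bullet> e x i)^2)) \<and>
        (\<Sum>i\<in>I x. (norm (e x i))^2) \<le> C \<and> norm (\<beta> x) \<le> C"
    and min: "\<And>x. x \<in> V \<Longrightarrow> m \<le> \<phi> x"
  shows "open {x \<in> V. \<phi> x = m}"
proof (subst open_contains_ball, intro ballI)
  fix x0 assume x0: "x0 \<in> {x \<in> V. \<phi> x = m}"
  obtain r l C where r: "r > 0" "l > 0"
    and ell: "\<And>x y. x \<in> V \<Longrightarrow> dist x0 x < r \<Longrightarrow> l * (norm y)^2 \<le> (\<Sum>i\<in>I x. (y \<bullet> e x i)^2)"
    and bd: "\<And>x. x \<in> V \<Longrightarrow> dist x0 x < r \<Longrightarrow> (\<Sum>i\<in>I x. (norm (e x i))^2) \<le> C"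
      "\<And>x. x \<in> V \<Longrightarrow> dist x0 x < r \<Longrightarrow> norm (\<beta> x) \<le> C"
  proof -
    from elliptic[of x0] x0 obtain r l C where "r > 0" "l > 0" and "\<forall>x\<in>V \<inter> ball x0 r.
        (\<forall>y. l * (norm y)^2 \<le> (\<Sum>i\<in>I x. (y \<bullet> e x i)^2)) \<and>
        (\<Sum>i\<in>I x. (norm (e x i))^2) \<le> C \<and> norm (\<beta> x) \<le> C"
      by blast
    then show ?thesis using that[of r l C] by simp
  qed
  obtain R0 where R0: "R0 > 0" "ball x0 R0 \<subseteq> V" using V x0 openE by auto
  define R where "R = min r R0"
  have R: "R > 0" using r R0 by (simp add: R_def)
  have inV: "x \<in> V" and inr: "dist x0 x < r" if "dist x0 x < R" for x
    using that R0 by (auto simp: R_def)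
  have cont: "continuous_on V \<phi>"
    using d1 has_derivative_at_withinI has_derivative_continuous_on by blast
  show "\<exists>d>0. ball x0 d \<subseteq> {x \<in> V. \<phi> x = m}"
  proof (intro exI conjI subsetI)
    show "R / 4 > 0" using R by simp
    fix y assume y: "y \<in> ball x0 (R / 4)"
    have yV: "y \<in> V" using y R by (intro inV) simp
    have "\<phi> y = m"
    proof (rule ccontr)
      assume ym: "\<phi> y \<noteq> m"
      \<comment> \<open>The nearest point \<open>z\<close> of the minimum set lies within \<open>R/2\<close> of \<open>x0\<close>; the larger radius leaves room for a ball around it.\<close>
      define Z where "Z = cball x0 (3/4 * R) \<inter> \<phi> -` {m}"
      have cbV: "cball x0 (3/4 * R) \<subseteq> V" using R by (auto intro: inV)
      have "closed Z" unfolding Z_def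
        by (intro continuous_closed_preimage continuous_on_subset[OF cont cbV]) auto
      moreover have x0Z: "x0 \<in> Z" using x0 R by (simp add: Z_def)
      ultimately obtain z where z: "z \<in> Z" and zmin: "\<And>x. x \<in> Z \<Longrightarrow> dist y z \<le> dist y x"
        using distance_attains_inf[of Z y] by auto
      define c where "c = midpoint y z"
      define \<rho> where "\<rho> = dist y z / 2"
      have "y \<noteq> z" using z ym by (auto simp: Z_def)
      then have \<rho>: "\<rho> > 0" by (simp add: \<rho>_def)
      have yz: "dist y z < R / 4" using zmin[OF x0Z] y by (simp add: dist_commute)
      have \<rho>R: "\<rho> < R / 8" using yz by (simp add: \<rho>_def)
      have x0z: "dist x0 z < R / 2" using dist_triangle[of x0 z y] y yz by simp
      have zc: "dist c z = \<rho>" by (simp add: c_def \<rho>_def dist_midpoint)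
      have near: "dist x0 x < 3/4 * R" if "dist z x \<le> \<rho> / 2" for x
        using dist_triangle[of x0 x z] x0z \<rho>R that \<rho> by simp
      have only: "x = z" if "dist c x \<le> \<rho>" "\<phi> x = m" "dist z x \<le> \<rho> / 2" for x
      proof (rule unique_point_of_internally_tangent_ball)
        show "dist y z \<le> dist y x"
          using near[OF that(3)] that(2) by (intro zmin) (simp add: Z_def)
        show "dist (midpoint y z) x \<le> dist y z / 2" using that(1) by (simp add: c_def \<rho>_def)
      qed
      \<comment> \<open>Chosen so that \<open>2 k l (\<rho>/2)\<^sup>2\<close> exceeds the trace and drift terms, which are at most \<open>C + 2 \<rho> C\<close> near \<open>z\<close>.\<close>
      define k where "k = (C * (1 + 2 * \<rho>) + 1) / (l * \<rho>^2 / 2)"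
      have lr: "l * \<rho>^2 / 2 > 0" using r \<rho> by simp
      have C0: "C \<ge> 0" using order_trans[OF norm_ge_zero bd(2)[of x0]] x0 r by simp
      have k: "k > 0" using lr C0 \<rho> unfolding k_def by (intro divide_pos_pos add_nonneg_pos) auto
      have kl: "k * (l * \<rho>^2 / 2) = C * (1 + 2 * \<rho>) + 1" unfolding k_def
        by (rule nonzero_eq_divide_eq[THEN iffD1, OF _ refl]) (use lr in linarith)
      define G where "G x = exp (- k * ((x - c) \<bullet> (x - c)))" for x
      define w where "w x = G x - exp (- k * \<rho>^2)" for x
      have Gd: "G x = exp (- k * (dist c x)^2)" for x
        by (simp add: G_def dist_norm power2_norm_eq_inner norm_minus_commute[of c])
      have wz: "w z = 0" using zc by (simp add: w_def Gd)
      have w1: "w x \<le> 1" for x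
      proof -
        have "G x \<le> 1" unfolding Gd using k by simp
        then show ?thesis unfolding w_def using exp_ge_zero[of "- k * \<rho>^2"] by linarith
      qed
      have wneg: "w x < 0" if "dist c x > \<rho>" for x
      proof -
        have "\<rho>^2 < (dist c x)^2" using that \<rho> by (intro power_strict_mono) auto
        then show ?thesis using k by (simp add: w_def Gd)
      qed
      define K where "K = sphere z (\<rho> / 2) \<inter> cball c \<rho>"
      have Kgt: "\<phi> x > m" if "x \<in> K" for x
      proof -
        have x: "dist z x = \<rho> / 2" "dist c x \<le> \<rho>" using that by (auto simp: K_def)
        have "x \<noteq> z" using x \<rho> by auto
        then have "\<phi> x \<noteq> m" using only[of x] x by auto
        moreover have "x \<in> V" using near[of x] x R by (intro inV) auto
        ultimately show ?thesis using min[of x] by simp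
      qed
      have KV: "K \<subseteq> V" using near R by (force simp: K_def intro!: inV)
      obtain \<delta> where \<delta>: "\<delta> > 0" "\<And>x. x \<in> K \<Longrightarrow> \<phi> x \<ge> m + \<delta>"
      proof (cases "K = {}")
        case True then show ?thesis using that[of 1] by simp
      next
        case False
        have "compact K" unfolding K_def by (intro compact_Int_closed) auto
        then obtain x1 where "x1 \<in> K" "\<And>x. x \<in> K \<Longrightarrow> \<phi> x1 \<le> \<phi> x"
          using continuous_attains_inf[OF _ False continuous_on_subset[OF cont KV]] by auto
        then show ?thesis using that[of "\<phi> x1 - m"] Kgt[of x1] by simp
      qed
      define \<zeta> where "\<zeta> x = \<phi> x - \<delta> / 2 * w x" for x
      have \<zeta>z: "\<zeta> z = m" using z wz by (simp add: \<zeta>_def Z_def)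
      \<comment> \<open>On the small sphere either \<open>\<phi>\<close> is at least \<open>m + \<delta>\<close> or the barrier is negative.\<close>
      have \<zeta>S: "\<zeta> x > m" if "dist z x = \<rho> / 2" for x
      proof (cases "dist c x \<le> \<rho>")
        case True
        then have "x \<in> K" using that by (simp add: K_def)
        then have "\<phi> x \<ge> m + \<delta>" by (rule \<delta>)
        moreover have "\<delta> / 2 * w x \<le> \<delta> / 2 * 1" using \<delta>(1) w1[of x] by (intro mult_left_mono) auto
        ultimately show ?thesis using \<delta>(1) unfolding \<zeta>_def by linarith
      next
        case False
        then have "\<delta> / 2 * w x < 0" using wneg[of x] \<delta>(1) by (intro mult_pos_neg) auto
        moreover have "x \<in> V" using near[of x] that R by (intro inV) auto
        ultimately show ?thesis using min[of x] by (simp add: \<zeta>_def)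
      qed
      have cz: "cball z (\<rho> / 2) \<subseteq> V" using near R by (force intro!: inV)
      have "continuous_on (cball z (\<rho> / 2)) \<zeta>"
        unfolding \<zeta>_def w_def G_def by (intro continuous_intros continuous_on_subset[OF cont cz])
      then obtain x where x: "x \<in> cball z (\<rho> / 2)" and xmin: "\<And>y. y \<in> cball z (\<rho> / 2) \<Longrightarrow> \<zeta> x \<le> \<zeta> y"
        using continuous_attains_inf[of "cball z (\<rho> / 2)" \<zeta>] \<rho> by auto
      have "\<zeta> x \<le> m" using xmin[of z] \<rho> \<zeta>z by simp
      then have "dist z x \<noteq> \<rho> / 2" using \<zeta>S[of x] by auto
      then have xb: "x \<in> ball z (\<rho> / 2)" using x by simp
      have xV: "x \<in> V" using x cz by auto
      have xr: "dist x0 x < r" using near[of x] x R by (intro inr) auto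
      define \<zeta>' where "\<zeta>' y v = \<phi>' y v - \<delta> / 2 * (- 2 * k * ((y - c) \<bullet> v) * G y)" for y v
      define \<zeta>'' where "\<zeta>'' v u = \<phi>'' x v u - \<delta> / 2 *
        (G x * (4 * k^2 * ((x - c) \<bullet> v) * ((x - c) \<bullet> u) - 2 * k * (u \<bullet> v)))" for v u
      have G1: "(G has_derivative (\<lambda>v. - 2 * k * ((y - c) \<bullet> v) * G y)) (at y)" for y
        using gaussian_derivatives(1) unfolding G_def[abs_def] .
      have G2: "((\<lambda>y. - 2 * k * ((y - c) \<bullet> v) * G y) has_derivative
         (\<lambda>u. G x * (4 * k^2 * ((x - c) \<bullet> v) * ((x - c) \<bullet> u) - 2 * k * (u \<bullet> v)))) (at x)" for v
        using gaussian_derivatives(2) unfolding G_def[abs_def] .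
      have \<zeta>d1: "(\<zeta> has_derivative \<zeta>' y) (at y)" if "y \<in> ball z (\<rho> / 2)" for y
      proof -
        have "y \<in> V" using that cz ball_subset_cball by blast
        have "((\<lambda>y. \<phi> y - \<delta> / 2 * (G y - exp (- k * \<rho>^2))) has_derivative
            (\<lambda>v. \<phi>' y v - \<delta> / 2 * ((- 2 * k * ((y - c) \<bullet> v) * G y) - 0))) (at y)"
          by (intro has_derivative_diff has_derivative_mult_right d1 \<open>y \<in> V\<close> G1 has_derivative_const)
        then show ?thesis by (simp add: \<zeta>_def[abs_def] \<zeta>'_def[abs_def] w_def)
      qed
      have \<zeta>d2: "((\<lambda>y. \<zeta>' y v) has_derivative \<zeta>'' v) (at x)" for v
        unfolding \<zeta>'_def \<zeta>''_def[abs_def]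
        by (intro has_derivative_diff has_derivative_mult_right d2 xV G2)
      have tests: "\<zeta>' x v = 0" "0 \<le> \<zeta>'' v v" for v
        using local_min_derivative_tests[OF open_ball xb \<zeta>d1 \<zeta>d2 xmin] by auto
      define q where "q = (\<Sum>i\<in>I x. ((x - c) \<bullet> e x i)^2)"
      define s where "s = (\<Sum>i\<in>I x. (norm (e x i))^2)"
      have "0 \<le> (\<Sum>i\<in>I x. \<zeta>'' (e x i) (e x i))" by (intro sum_nonneg tests)
      also have "\<dots> = (\<Sum>i\<in>I x. \<phi>'' x (e x i) (e x i)) - \<delta> / 2 * G x * (4 * k^2 * q - 2 * k * s)"
      proof -
        have "\<zeta>'' (e x i) (e x i) = \<phi>'' x (e x i) (e x i)
            - \<delta> / 2 * G x * (4 * k^2 * ((x - c) \<bullet> e x i)^2 - 2 * k * (norm (e x i))^2)" for i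
          unfolding \<zeta>''_def by (simp add: power2_norm_eq_inner power2_eq_square[of "(x - c) \<bullet> e x i"])
        then show ?thesis by (simp only: sum_subtractf q_def s_def sum_distrib_left right_diff_distrib)
      qed
      finally have "\<delta> / 2 * G x * (4 * k^2 * q - 2 * k * s) \<le> (\<Sum>i\<in>I x. \<phi>'' x (e x i) (e x i))" by simp
      also have "\<dots> \<le> - \<phi>' x (\<beta> x)" using super[OF xV] by simp
      also have "\<dots> = \<delta> / 2 * G x * (2 * k * ((x - c) \<bullet> \<beta> x))"
        using tests(1)[of "\<beta> x"] by (simp add: \<zeta>'_def eq_neg_iff_add_eq_0 mult_ac)
      finally have "4 * k^2 * q - 2 * k * s \<le> 2 * k * ((x - c) \<bullet> \<beta> x)"
        using \<delta>(1) by (simp add: G_def)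
      then have "(2 * k) * (2 * k * q - s) \<le> (2 * k) * ((x - c) \<bullet> \<beta> x)"
        by (simp add: power2_eq_square algebra_simps)
      then have key: "2 * k * q \<le> s + (x - c) \<bullet> \<beta> x"
        using k by simp
      have cx: "dist c x \<ge> \<rho> / 2" "dist c x \<le> 2 * \<rho>"
        using dist_triangle[of c z x] dist_triangle[of c x z] zc xb \<rho>
        by (auto simp: dist_commute)
      have "(\<rho> / 2)^2 \<le> (norm (x - c))^2"
        using cx(1) \<rho> by (intro power_mono) (auto simp: dist_norm norm_minus_commute)
      then have "l * (\<rho> / 2)^2 \<le> l * (norm (x - c))^2" using r by (intro mult_left_mono) auto
      also have "\<dots> \<le> q" unfolding q_def by (rule ell[OF xV xr])
      finally have "2 * k * (l * (\<rho> / 2)^2) \<le> 2 * k * q" using k by (intro mult_left_mono) auto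
      moreover have "2 * k * (l * (\<rho> / 2)^2) = k * (l * \<rho>^2 / 2)" by (simp add: power2_eq_square)
      moreover have "(x - c) \<bullet> \<beta> x \<le> 2 * \<rho> * C"
      proof -
        have "(x - c) \<bullet> \<beta> x \<le> norm (x - c) * norm (\<beta> x)" by (rule norm_cauchy_schwarz)
        also have "\<dots> \<le> 2 * \<rho> * C"
          using cx(2) bd(2)[OF xV xr] \<rho> by (intro mult_mono) (auto simp: dist_norm norm_minus_commute)
        finally show ?thesis .
      qed
      moreover have "s \<le> C" unfolding s_def by (rule bd(1)[OF xV xr])
      moreover have "C * (1 + 2 * \<rho>) = C + 2 * \<rho> * C" by (simp add: algebra_simps)
      ultimately show False using key kl by linarith
    qed
    then show "y \<in> {x \<in> V. \<phi> x = m}" using yV by simp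
  qed
qed


section \<open>Hypersurface patches: Codazzi equation and Laplacians\<close>

lemma has_derivative_inner_dird:
  assumes "smooth_on g S" "smooth_on k S" "x \<in> S"
  shows "((\<lambda>x. g x \<bullet> k x) has_derivative (\<lambda>v. g x \<bullet> dird k v x + dird g v x \<bullet> k x)) (at x)"
  by (intro has_derivative_inner smooth_on_has_derivative[OF assms(1,3)] smooth_on_has_derivative[OF assms(2,3)])

lemma has_derivative_const_on_open:
  assumes "open S" "x \<in> S" "(g has_derivative g') (at x)" "\<And>y. y \<in> S \<Longrightarrow> g y = c"
  shows "g' v = 0"
proof -
  have "((\<lambda>_. c) has_derivative g') (at x)"
    by (rule has_derivative_transform_within_open[OF assms(3,1,2)]) (use assms(4) in auto)
  then show ?thesis using has_derivative_unique[of "\<lambda>_. c" g' x "\<lambda>_. 0"] by (simp add: fun_eq_iff)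
qed

locale hypersurface_patch =
  fixes V :: "'a::euclidean_space set" and f \<nu> :: "'a \<Rightarrow> 'b::euclidean_space"
  assumes dim: "DIM('b) = DIM('a) + 1"
    and V: "open V"
    and f: "smooth_on f V"
    and \<nu>: "smooth_on \<nu> V"
    and inj_dird: "\<And>x. x \<in> V \<Longrightarrow> inj (\<lambda>v. dird f v x)"
    and unit: "\<And>x. x \<in> V \<Longrightarrow> norm (\<nu> x) = 1"
    and normal: "\<And>x v. x \<in> V \<Longrightarrow> \<nu> x \<bullet> dird f v x = 0"
begin

text \<open>The parameter direction of the tangential part of an ambient vector. Composing with the orthogonal projection
  makes it linear on the whole space.\<close>

definition pull :: "'a \<Rightarrow> 'b \<Rightarrow> 'a" where
  "pull x z = inv (\<lambda>v. dird f v x) (z - (z \<bullet> \<nu> x) *\<^sub>R \<nu> x)"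

definition frame :: "'a \<Rightarrow> 'b set \<Rightarrow> bool" where
  "frame x B \<longleftrightarrow> pairwise orthogonal B \<and> (\<forall>e\<in>B. norm e = 1) \<and> span B = range (\<lambda>v. dird f v x)"

text \<open>The mean curvature with the sign convention \<open>H = - \<langle>trace A, n\<rangle>\<close>: the trace of the endomorphism
  that sends a parameter direction \<open>v\<close> to the one representing \<open>D\<nu>(v)\<close>. Being a trace on the fixed space
  \<open>'a\<close> it can be differentiated without a moving frame.\<close>

definition mc :: "'a \<Rightarrow> real" where
  "mc x = (\<Sum>i\<in>Basis. pull x (dird \<nu> i x) \<bullet> i)"

text \<open>The derivative of the trace, with the endomorphism differentiated as the solution of the linear
  system \<open>Df(S i) = D\<nu>(i)\<close>; see \<open>mc_has_derivative\<close>.\<close>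

definition mc_deriv :: "'a \<Rightarrow> 'a \<Rightarrow> real" where
  "mc_deriv x w = (\<Sum>i\<in>Basis. (pull x (dird (dird \<nu> i) w x)
      - pull x (dird (dird f (pull x (dird \<nu> i x))) w x)) \<bullet> i)"

context
  fixes x assumes x: "x \<in> V"
begin

lemmas linear_df = linear_dird[OF f x] and linear_d\<nu> = linear_dird[OF \<nu> x]
lemmas linear_ddf = linear_dird[OF smooth_on_dird[OF f] x] linear_dird_dird[OF f V x]
lemmas linear_dd\<nu> = linear_dird[OF smooth_on_dird[OF \<nu>] x] linear_dird_dird[OF \<nu> V x]

lemma \<nu>_inner_self: "\<nu> x \<bullet> \<nu> x = 1"
  using unit[OF x] by (simp add: norm_eq_1)

lemma range_df: "range (\<lambda>v. dird f v x) = {z. \<nu> x \<bullet> z = 0}"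
proof (rule subspace_dim_equal)
  show "subspace (range (\<lambda>v. dird f v x))"
    using linear_df by (intro linear_subspace_image) auto
  have "\<nu> x \<noteq> 0" using unit[OF x] by auto
  then have "dim {z. \<nu> x \<bullet> z = 0} = DIM('a)" using dim by (simp add: dim_hyperplane)
  moreover have "dim (range (\<lambda>v. dird f v x)) = DIM('a)"
    using dim_image_eq[OF linear_df, of UNIV] inj_dird[OF x] by (simp add: dim_UNIV)
  ultimately show "dim (range (\<lambda>v. dird f v x)) \<ge> dim {z. \<nu> x \<bullet> z = 0}" by simp
qed (use normal[OF x] subspace_hyperplane in auto)

lemma df_pull: "dird f (pull x z) x = z - (z \<bullet> \<nu> x) *\<^sub>R \<nu> x"
proof -
  have "z - (z \<bullet> \<nu> x) *\<^sub>R \<nu> x \<in> range (\<lambda>v. dird f v x)"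
    unfolding range_df by (simp add: inner_diff_right \<nu>_inner_self inner_commute)
  then show ?thesis unfolding pull_def by (rule f_inv_into_f)
qed

lemma pull_unique: "dird f v x = z - (z \<bullet> \<nu> x) *\<^sub>R \<nu> x \<Longrightarrow> pull x z = v"
  using injD[OF inj_dird[OF x]] df_pull by metis

lemma pull_df: "pull x (dird f v x) = v"
  using normal[OF x] by (intro pull_unique) (simp add: inner_commute)

lemma linear_pull: "linear (pull x)"
  by (rule linearI; rule pull_unique)
     (simp_all add: linear_add[OF linear_df] linear_scale[OF linear_df] df_pull algebra_simps)

lemma d\<nu>_\<nu>: "dird \<nu> v x \<bullet> \<nu> x = 0"
  using has_derivative_const_on_open[OF V x has_derivative_inner_dird[OF \<nu> \<nu> x], of 1 v] unit
  by (simp add: norm_eq_1 inner_commute)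

lemma dd\<nu>_\<nu>: "dird (dird \<nu> v) w x \<bullet> \<nu> x = - (dird \<nu> v x \<bullet> dird \<nu> w x)"
proof -
  have "dird \<nu> v y \<bullet> \<nu> y = 0" if "y \<in> V" for y
    using has_derivative_const_on_open[OF V that has_derivative_inner_dird[OF \<nu> \<nu> that], of 1 v] unit
    by (simp add: norm_eq_1 inner_commute)
  then show ?thesis
    using has_derivative_const_on_open[OF V x has_derivative_inner_dird[OF smooth_on_dird[OF \<nu>] \<nu> x], of v 0 w]
    by simp
qed

lemma ddf_\<nu>: "dird (dird f v) w x \<bullet> \<nu> x = - (dird f v x \<bullet> dird \<nu> w x)"
  using has_derivative_const_on_open[OF V x has_derivative_inner_dird[OF smooth_on_dird[OF f] \<nu> x], of v 0 w]
    normal by (simp add: inner_commute)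

lemma df_pull_d\<nu>: "dird f (pull x (dird \<nu> v x)) x = dird \<nu> v x"
  by (simp add: df_pull d\<nu>_\<nu>)

end

text \<open>Both sides are \<open>- \<langle>\<nu>, D\<^sup>2f(v, w)\<rangle>\<close>.\<close>

lemma d\<nu>_symmetric:
  assumes "x \<in> V"
  shows "dird \<nu> v x \<bullet> dird f w x = dird \<nu> w x \<bullet> dird f v x"
  using ddf_\<nu>[OF assms, of v w] ddf_\<nu>[OF assms, of w v] dird_commute[OF f V assms, of v w]
  by (simp add: inner_commute)

text \<open>Differentiating the symmetry of the second fundamental form: the Codazzi equation.\<close>

lemma codazzi:
  assumes "x \<in> V"
  shows "dird (dird \<nu> v) z x \<bullet> dird f w x + dird \<nu> v x \<bullet> dird (dird f w) z x
       = dird (dird \<nu> w) z x \<bullet> dird f v x + dird \<nu> w x \<bullet> dird (dird f v) z x"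
proof -
  have "((\<lambda>x. dird \<nu> v x \<bullet> dird f w x - dird \<nu> w x \<bullet> dird f v x) has_derivative
      (\<lambda>z. (dird \<nu> v x \<bullet> dird (dird f w) z x + dird (dird \<nu> v) z x \<bullet> dird f w x)
        - (dird \<nu> w x \<bullet> dird (dird f v) z x + dird (dird \<nu> w) z x \<bullet> dird f v x))) (at x)"
    by (intro has_derivative_diff has_derivative_inner_dird[OF smooth_on_dird[OF \<nu>] smooth_on_dird[OF f] assms])
  from has_derivative_const_on_open[OF V assms this, of 0 z] d\<nu>_symmetric
  show ?thesis by simp
qed

lemma mc_has_derivative:
  assumes x: "x \<in> V"
  shows "(mc has_derivative mc_deriv x) (at x)"
proof -
  have "((\<lambda>y. pull y (dird \<nu> i y)) has_derivative
      (\<lambda>w. pull x (dird (dird \<nu> i) w x) -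
        (\<Sum>j\<in>Basis. (pull x (dird \<nu> i x) \<bullet> j) *\<^sub>R pull x (dird (dird f j) w x)))) (at x)" for i
  proof (rule has_derivative_linear_system_solution[where A="\<lambda>y v. dird f v y" and y="dird \<nu> i" and S=V])
    show "linear (\<lambda>v. dird f v y)" if "y \<in> V" for y by (rule linear_dird[OF f that])
    show "(dird f v has_derivative (\<lambda>w. dird (dird f v) w x)) (at x)" for v
      by (rule smooth_on_has_derivative[OF smooth_on_dird[OF f] x])
    show "(dird \<nu> i has_derivative (\<lambda>w. dird (dird \<nu> i) w x)) (at x)"
      by (rule smooth_on_has_derivative[OF smooth_on_dird[OF \<nu>] x])
  qed (use V x df_pull_d\<nu> linear_pull pull_df in auto)
  moreover have "(\<Sum>j\<in>Basis. (v \<bullet> j) *\<^sub>R pull x (dird (dird f j) w x)) = pull x (dird (dird f v) w x)" for v w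
  proof -
    have L: "linear (\<lambda>v. pull x (dird (dird f v) w x))"
      using linear_compose[OF linear_dird_dird[OF f V x] linear_pull[OF x]] by (simp add: o_def)
    show ?thesis
      by (subst (2) euclidean_representation[symmetric, of v])
         (simp add: linear_sum[OF L] linear_scale[OF L])
  qed
  ultimately have "((\<lambda>y. pull y (dird \<nu> i y)) has_derivative
      (\<lambda>w. pull x (dird (dird \<nu> i) w x) - pull x (dird (dird f (pull x (dird \<nu> i x))) w x))) (at x)" for i
    by simp
  then show ?thesis
    unfolding mc_def[abs_def] mc_deriv_def[abs_def]
    by (intro has_derivative_sum has_derivative_inner_left)
qed

end

locale patch_frame = hypersurface_patch V f \<nu>
  for V :: "'a::euclidean_space set" and f \<nu> :: "'a \<Rightarrow> 'b::euclidean_space" +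
  fixes x :: 'a and B :: "'b set"
  assumes x: "x \<in> V" and frame: "frame x B"
begin

abbreviation e :: "'b \<Rightarrow> 'a" where "e \<equiv> pull x"

lemma finite_frame: "finite B" and card_frame: "card B = DIM('a)"
proof -
  have ind: "independent B"
    using frame unfolding frame_def by (intro pairwise_orthogonal_independent) auto
  then show "finite B" by (rule independent_imp_finite)
  have "card B = dim (range (\<lambda>v. dird f v x))"
    using frame dim_span_eq_card_independent[OF ind] by (simp add: frame_def)
  also have "\<dots> = DIM('a)"
    using dim_image_eq[OF linear_df[OF x], of UNIV] inj_dird[OF x] by (simp add: dim_UNIV)
  finally show "card B = DIM('a)" .
qed

lemma frame_normal: "b \<in> B \<Longrightarrow> b \<bullet> \<nu> x = 0"
  using frame range_df[OF x] span_superset[of B] unfolding frame_def by (auto simp: inner_commute)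

lemma frame_unit: "b \<in> B \<Longrightarrow> b \<bullet> b = 1"
  using frame by (simp add: frame_def norm_eq_1)

lemma df_e: "b \<in> B \<Longrightarrow> dird f (e b) x = b"
  by (simp add: df_pull[OF x] frame_normal)

lemma tangent_expand: "z \<bullet> \<nu> x = 0 \<Longrightarrow> (\<Sum>b\<in>B. (z \<bullet> b) *\<^sub>R b) = z"
  using frame range_df[OF x] finite_frame unfolding frame_def
  by (intro orthonormal_basis_expand) (auto simp: inner_commute)

lemma inner_expand:
  assumes "z \<bullet> \<nu> x = 0"
  shows "z \<bullet> y = (\<Sum>b\<in>B. (z \<bullet> b) * (b \<bullet> y))"
  by (subst tangent_expand[OF assms, symmetric]) (simp add: inner_sum_left)

lemma norm_expand: "z \<bullet> \<nu> x = 0 \<Longrightarrow> (norm z)^2 = (\<Sum>b\<in>B. (z \<bullet> b)^2)"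
  using inner_expand[of z z] unfolding power2_norm_eq_inner by (simp add: power2_eq_square inner_commute)

lemma pull_expand:
  assumes "z \<bullet> \<nu> x = 0"
  shows "pull x z = (\<Sum>b\<in>B. (z \<bullet> b) *\<^sub>R e b)"
  by (subst tangent_expand[OF assms, symmetric])
     (simp add: linear_sum[OF linear_pull[OF x]] linear_scale[OF linear_pull[OF x]])

text \<open>Expanding \<open>Df(i)\<close> in the frame and exchanging the sums expresses the trace by the orthonormal frame of the
  tangent space, although the directions \<open>e b\<close> are not orthonormal in the parameter space.\<close>

lemma trace_frame:
  assumes L: "linear L"
  shows "(\<Sum>i\<in>Basis. L i \<bullet> i) = (\<Sum>b\<in>B. b \<bullet> dird f (L (e b)) x)"
proof -
  have i: "L i = (\<Sum>b\<in>B. (dird f i x \<bullet> b) *\<^sub>R L (e b))" for i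
  proof -
    have "i = (\<Sum>b\<in>B. (dird f i x \<bullet> b) *\<^sub>R e b)"
      using pull_df[OF x, of i] pull_expand[of "dird f i x"] normal[OF x] by (simp add: inner_commute)
    then have "L i = L (\<Sum>b\<in>B. (dird f i x \<bullet> b) *\<^sub>R e b)" by simp
    then show ?thesis by (simp add: linear_sum[OF L] linear_scale[OF L])
  qed
  have "(\<Sum>i\<in>Basis. L i \<bullet> i) = (\<Sum>i\<in>Basis. \<Sum>b\<in>B. (dird f i x \<bullet> b) * (L (e b) \<bullet> i))"
    by (intro sum.cong refl, subst i) (simp add: inner_sum_left)
  also have "\<dots> = (\<Sum>b\<in>B. \<Sum>i\<in>Basis. (L (e b) \<bullet> i) * (b \<bullet> dird f i x))"
    by (subst sum.swap) (simp add: inner_commute mult.commute)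
  also have "\<dots> = (\<Sum>b\<in>B. b \<bullet> dird f (\<Sum>i\<in>Basis. (L (e b) \<bullet> i) *\<^sub>R i) x)"
    by (simp add: linear_sum[OF linear_df[OF x]] linear_scale[OF linear_df[OF x]] inner_sum_right)
  finally show ?thesis by (simp add: euclidean_representation)
qed

lemma mc_frame: "mc x = (\<Sum>b\<in>B. b \<bullet> dird \<nu> (e b) x)"
proof -
  have "linear (\<lambda>v. pull x (dird \<nu> v x))"
    using linear_compose[OF linear_d\<nu>[OF x] linear_pull[OF x]] by (simp add: o_def)
  from trace_frame[OF this] show ?thesis
    unfolding mc_def by (simp add: df_pull_d\<nu>[OF x])
qed

lemma mc_deriv_frame:
  "mc_deriv x w = (\<Sum>b\<in>B. b \<bullet> dird (dird \<nu> (e b)) w x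
      - b \<bullet> dird (dird f (pull x (dird \<nu> (e b) x))) w x)"
proof -
  have "linear (\<lambda>v. pull x (dird (dird \<nu> v) w x) - pull x (dird (dird f (pull x (dird \<nu> v x))) w x))"
    using linear_compose[OF linear_dd\<nu>(2)[OF x] linear_pull[OF x]]
      linear_compose[OF linear_compose[OF linear_compose[OF linear_d\<nu>[OF x] linear_pull[OF x]]
        linear_ddf(2)[OF x]] linear_pull[OF x]]
    by (intro linear_compose_sub) (simp_all add: o_def)
  from trace_frame[OF this] show ?thesis
    unfolding mc_deriv_def
    by (simp add: linear_diff[OF linear_df[OF x]] df_pull[OF x] inner_diff_right frame_normal)
qed

text \<open>The Laplacian of the induced metric: the trace of the Hessian \<open>D\<^sup>2g(X, X) - Dg(\<nabla>\<^sub>X X)\<close>, where \<open>\<nabla>\<^sub>X X\<close> is the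
  tangential part of \<open>D\<^sup>2f(X, X)\<close>.\<close>

definition laplacian :: "('a \<Rightarrow> 'c::euclidean_space) \<Rightarrow> 'c" where
  "laplacian g = (\<Sum>b\<in>B. dird (dird g (e b)) (e b) x
      - dird g (pull x (dird (dird f (e b)) (e b) x)) x)"

text \<open>The traced Codazzi equation: the tangential part of \<open>\<Delta>\<nu>\<close> is the gradient of the mean curvature. The
  Codazzi equation exchanges the roles of \<open>w\<close> and \<open>e b\<close>; the first-order terms that remain agree with
  those in the derivative of the trace because the second fundamental form is symmetric.\<close>

lemma tangential_laplacian_\<nu>: "dird f w x \<bullet> laplacian \<nu> = mc_deriv x w"
proof -
  have 1: "(\<Sum>b\<in>B. b \<bullet> dird (dird f (pull x (dird \<nu> (e b) x))) w x)
      = (\<Sum>b\<in>B. dird \<nu> (e b) x \<bullet> dird (dird f (e b)) w x)"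
  proof -
    have "dird (dird f (pull x (dird \<nu> v x))) w x
        = (\<Sum>c\<in>B. (dird \<nu> v x \<bullet> c) *\<^sub>R dird (dird f (e c)) w x)" for v
      by (subst pull_expand[OF d\<nu>_\<nu>[OF x]])
         (simp add: linear_sum[OF linear_ddf(2)[OF x]] linear_scale[OF linear_ddf(2)[OF x]])
    then have "(\<Sum>b\<in>B. b \<bullet> dird (dird f (pull x (dird \<nu> (e b) x))) w x)
        = (\<Sum>b\<in>B. \<Sum>c\<in>B. (dird \<nu> (e b) x \<bullet> c) * (b \<bullet> dird (dird f (e c)) w x))"
      by (simp add: inner_sum_right)
    also have "\<dots> = (\<Sum>c\<in>B. \<Sum>b\<in>B. (dird \<nu> (e b) x \<bullet> c) * (b \<bullet> dird (dird f (e c)) w x))"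
      by (rule sum.swap)
    also have "\<dots> = (\<Sum>c\<in>B. \<Sum>b\<in>B. (dird \<nu> (e c) x \<bullet> b) * (b \<bullet> dird (dird f (e c)) w x))"
    proof (intro sum.cong refl)
      fix c b assume "c \<in> B" "b \<in> B"
      then show "(dird \<nu> (e b) x \<bullet> c) * (b \<bullet> dird (dird f (e c)) w x)
          = (dird \<nu> (e c) x \<bullet> b) * (b \<bullet> dird (dird f (e c)) w x)"
        using d\<nu>_symmetric[OF x, of "e b" "e c"] by (simp add: df_e)
    qed
    also have "\<dots> = (\<Sum>c\<in>B. dird \<nu> (e c) x \<bullet> dird (dird f (e c)) w x)"
      by (intro sum.cong refl inner_expand[symmetric] d\<nu>_\<nu>[OF x])
    finally show ?thesis .
  qed
  have 2: "dird f w x \<bullet> (dird (dird \<nu> (e b)) (e b) x - dird \<nu> (pull x (dird (dird f (e b)) (e b) x)) x)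
      = b \<bullet> dird (dird \<nu> (e b)) w x - dird \<nu> (e b) x \<bullet> dird (dird f (e b)) w x" if b: "b \<in> B" for b
  proof -
    let ?z = "dird (dird f (e b)) (e b) x"
    have "dird f w x \<bullet> dird \<nu> (pull x ?z) x = dird \<nu> w x \<bullet> dird f (pull x ?z) x"
      using d\<nu>_symmetric[OF x, of "pull x ?z" w] by (simp add: inner_commute)
    also have "\<dots> = dird \<nu> w x \<bullet> ?z"
      by (simp add: df_pull[OF x] inner_diff_right d\<nu>_\<nu>[OF x])
    finally have "dird f w x \<bullet> dird \<nu> (pull x ?z) x = dird \<nu> w x \<bullet> ?z" .
    moreover have "dird (dird \<nu> (e b)) (e b) x \<bullet> dird f w x + dird \<nu> (e b) x \<bullet> dird (dird f w) (e b) x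
       = dird (dird \<nu> w) (e b) x \<bullet> b + dird \<nu> w x \<bullet> ?z"
      using codazzi[OF x, of "e b" "e b" w] b by (simp add: df_e)
    moreover have "dird (dird f w) (e b) x = dird (dird f (e b)) w x"
      "dird (dird \<nu> w) (e b) x = dird (dird \<nu> (e b)) w x"
      by (rule dird_commute[OF f V x] dird_commute[OF \<nu> V x])+
    ultimately show ?thesis by (simp add: inner_diff_right inner_commute)
  qed
  show ?thesis
    unfolding laplacian_def mc_deriv_frame inner_sum_right
    using 1 2 by (simp add: sum_subtractf)
qed

text \<open>As \<open>D\<nu>(v)\<close> is tangential, this is \<open>|A|\<^sup>2\<close>.\<close>

definition norm_sq_A :: real where
  "norm_sq_A = (\<Sum>b\<in>B. (norm (dird \<nu> (e b) x))^2)"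

lemma normal_laplacian_\<nu>: "laplacian \<nu> \<bullet> \<nu> x = - norm_sq_A"
  unfolding laplacian_def norm_sq_A_def
  by (simp add: inner_sum_left inner_diff_left d\<nu>_\<nu>[OF x] dd\<nu>_\<nu>[OF x] power2_norm_eq_inner sum_negf)

lemma laplacian_f: "laplacian f = - mc x *\<^sub>R \<nu> x"
proof -
  have "laplacian f = (\<Sum>b\<in>B. (dird (dird f (e b)) (e b) x \<bullet> \<nu> x) *\<^sub>R \<nu> x)"
    unfolding laplacian_def by (intro sum.cong refl) (simp add: df_pull[OF x])
  also have "\<dots> = (\<Sum>b\<in>B. - (b \<bullet> dird \<nu> (e b) x) *\<^sub>R \<nu> x)"
    by (intro sum.cong refl) (simp add: ddf_\<nu>[OF x] df_e)
  finally show ?thesis by (simp add: mc_frame sum_negf flip: scaleR_sum_left)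
qed

end


section \<open>Drift Laplacians on a self-expander patch\<close>

context hypersurface_patch
begin

text \<open>The first-order part of the operator \<open>\<Delta> - (\<alpha>/2) \<langle>x\<^sup>T, \<nabla> \<cdot>\<rangle>\<close>, written so that the operator becomes
  \<open>\<Sum>\<^sub>b D\<^sup>2g(e\<^sub>b, e\<^sub>b) + Dg(drift)\<close>.\<close>

definition drift :: "real \<Rightarrow> 'a \<Rightarrow> 'b set \<Rightarrow> 'a" where
  "drift \<alpha> x B = - (\<Sum>b\<in>B. pull x (dird (dird f (pull x b)) (pull x b) x)) - (\<alpha> / 2) *\<^sub>R pull x (f x)"

text \<open>On a self-expander this is the mean curvature (\<open>mc_eq_h\<close> below). The product rule for \<open>h'\<close> would
  have the further term \<open>\<langle>Df(v), \<nu>\<rangle>\<close>, which is zero; leaving it out keeps \<open>D\<^sup>2f\<close> out of the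
  second derivative.\<close>

definition h :: "'a \<Rightarrow> real" where "h x = - (f x \<bullet> \<nu> x) / 2"

definition h' :: "'a \<Rightarrow> 'a \<Rightarrow> real" where "h' x v = - (f x \<bullet> dird \<nu> v x) / 2"

definition h'' :: "'a \<Rightarrow> 'a \<Rightarrow> 'a \<Rightarrow> real" where
  "h'' x v u = - (f x \<bullet> dird (dird \<nu> v) u x + dird f u x \<bullet> dird \<nu> v x) / 2"

definition r2' :: "'a \<Rightarrow> 'a \<Rightarrow> real" where "r2' x v = 2 * (f x \<bullet> dird f v x)"

definition r2'' :: "'a \<Rightarrow> 'a \<Rightarrow> 'a \<Rightarrow> real" where
  "r2'' x v u = 2 * (f x \<bullet> dird (dird f v) u x + dird f u x \<bullet> dird f v x)"

lemma h_has_derivative: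
  assumes "x \<in> V"
  shows "(h has_derivative h' x) (at x)"
proof -
  have "((\<lambda>x. f x \<bullet> \<nu> x) has_derivative (\<lambda>v. f x \<bullet> dird \<nu> v x + dird f v x \<bullet> \<nu> x)) (at x)"
    by (rule has_derivative_inner_dird[OF f \<nu> assms])
  from has_derivative_mult_right[OF this, of "- 1 / 2"] show ?thesis
    unfolding h_def[abs_def] h'_def[abs_def] using normal[OF assms] by (simp add: inner_commute)
qed

lemma h'_has_derivative:
  assumes "x \<in> V"
  shows "((\<lambda>y. h' y v) has_derivative h'' x v) (at x)"
  using has_derivative_mult_right[OF has_derivative_inner_dird[OF f smooth_on_dird[OF \<nu>] assms], of "- 1 / 2"]
  unfolding h'_def[abs_def] h''_def[abs_def] by (simp add: add_divide_distrib diff_divide_distrib)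

lemma r2_has_derivative:
  assumes "x \<in> V"
  shows "((\<lambda>x. f x \<bullet> f x) has_derivative r2' x) (at x)"
  using has_derivative_inner_dird[OF f f assms]
  unfolding r2'_def[abs_def] by (simp add: inner_commute)

lemma r2'_has_derivative:
  assumes "x \<in> V"
  shows "((\<lambda>y. r2' y v) has_derivative r2'' x v) (at x)"
  unfolding r2'_def[abs_def] r2''_def[abs_def]
  by (intro has_derivative_mult_right has_derivative_inner_dird[OF f smooth_on_dird[OF f] assms])

lemma position_decomposition:
  assumes "x \<in> V"
  shows "f x = dird f (pull x (f x)) x + (f x \<bullet> \<nu> x) *\<^sub>R \<nu> x"
  by (simp add: df_pull[OF assms])

end

context patch_frame
begin

text \<open>The identity \<open>\<Delta>f = - H \<nu>\<close> gives the Laplacian of \<open>|f|\<^sup>2\<close>; the drift adds \<open>- \<alpha>|f\<^sup>T|\<^sup>2\<close>.\<close>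

lemma r2_operator:
  "(\<Sum>b\<in>B. r2'' x (e b) (e b)) + r2' x (drift \<alpha> x B)
    = 2 * DIM('a) - 2 * mc x * (f x \<bullet> \<nu> x) - \<alpha> * ((norm (f x))^2 - (f x \<bullet> \<nu> x)^2)"
proof -
  have lin: "linear (r2' x)"
    using has_derivative_linear[OF r2_has_derivative[OF x]] .
  have 1: "(\<Sum>b\<in>B. r2'' x (e b) (e b)) - (\<Sum>b\<in>B. r2' x (pull x (dird (dird f (e b)) (e b) x)))
     = 2 * (f x \<bullet> laplacian f) + 2 * DIM('a)"
    unfolding r2''_def r2'_def laplacian_def
    by (simp add: df_e frame_unit sum.distrib inner_sum_right inner_diff_right sum_subtractf card_frame
        sum_distrib_left[symmetric])
  have 2: "r2' x (pull x (f x)) = 2 * ((norm (f x))^2 - (f x \<bullet> \<nu> x)^2)"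
    unfolding r2'_def
    by (simp add: df_pull[OF x] inner_diff_right power2_norm_eq_inner power2_eq_square[of "f x \<bullet> \<nu> x"])
  have "r2' x (drift \<alpha> x B) = - (\<Sum>b\<in>B. r2' x (pull x (dird (dird f (e b)) (e b) x)))
     - \<alpha> / 2 * r2' x (pull x (f x))"
    unfolding drift_def by (simp add: linear_diff[OF lin] linear_neg[OF lin] linear_sum[OF lin] linear_scale[OF lin])
  then show ?thesis using 1 unfolding 2 laplacian_f by (simp add: algebra_simps)
qed

end

locale expander_frame = patch_frame V f \<nu> x B
  for V :: "'a::euclidean_space set" and f \<nu> :: "'a \<Rightarrow> 'b::euclidean_space" and x B +
  assumes mc_eq_h: "\<And>y. y \<in> V \<Longrightarrow> mc y = h y"
begin

lemma mc_deriv_eq: "mc_deriv x w = h' x w"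
proof -
  have "(mc has_derivative h' x) (at x)"
    by (rule has_derivative_transform_within_open[OF h_has_derivative[OF x] V x])
       (simp add: mc_eq_h)
  then show ?thesis
    using has_derivative_unique[OF mc_has_derivative[OF x]] by metis
qed

text \<open>Since \<open>H = - \<langle>f, \<nu>\<rangle> / 2\<close>, its Laplacian needs only \<open>\<langle>f, \<Delta>\<nu>\<rangle>\<close>, besides the trace of
  \<open>\<langle>Df, D\<nu>\<rangle>\<close>, which is \<open>H\<close>. The tangential part of \<open>f\<close> meets the gradient of \<open>H\<close> in \<open>\<Delta>\<nu>\<close>, the normal part
  meets \<open>- |A|\<^sup>2\<close>.\<close>

lemma h_operator:
  "(\<Sum>b\<in>B. h'' x (e b) (e b)) + h' x (drift \<alpha> x B)
    = - (norm_sq_A * h x + h x / 2 + (\<alpha> + 1) / 2 * h' x (pull x (f x)))"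
proof -
  have lin: "linear (h' x)" using has_derivative_linear[OF h_has_derivative[OF x]] .
  have "(\<Sum>b\<in>B. h'' x (e b) (e b)) - (\<Sum>b\<in>B. h' x (pull x (dird (dird f (e b)) (e b) x)))
     = (\<Sum>b\<in>B. h'' x (e b) (e b) - h' x (pull x (dird (dird f (e b)) (e b) x)))"
    by (simp add: sum_subtractf)
  also have "\<dots> = (\<Sum>b\<in>B. - (1 / 2) * (f x \<bullet> (dird (dird \<nu> (e b)) (e b) x
      - dird \<nu> (pull x (dird (dird f (e b)) (e b) x)) x) + b \<bullet> dird \<nu> (e b) x))"
    by (intro sum.cong refl) (simp add: h''_def h'_def df_e inner_diff_right field_simps)
  also have "\<dots> = - (1 / 2) * (f x \<bullet> laplacian \<nu> + mc x)"
    unfolding sum_distrib_left[symmetric] laplacian_def mc_frame by (simp add: sum.distrib inner_sum_right)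
  also have "f x \<bullet> laplacian \<nu> = h' x (pull x (f x)) + 2 * h x * norm_sq_A"
    by (subst position_decomposition[OF x])
       (simp add: inner_add_left tangential_laplacian_\<nu> mc_deriv_eq inner_commute[of "\<nu> x"]
         normal_laplacian_\<nu> h_def)
  finally have 1: "(\<Sum>b\<in>B. h'' x (e b) (e b)) - (\<Sum>b\<in>B. h' x (pull x (dird (dird f (e b)) (e b) x)))
     = - (1 / 2) * (h' x (pull x (f x)) + 2 * h x * norm_sq_A + h x)"
    by (simp add: mc_eq_h[OF x])
  have "h' x (drift \<alpha> x B) = - (\<Sum>b\<in>B. h' x (pull x (dird (dird f (e b)) (e b) x)))
     - \<alpha> / 2 * h' x (pull x (f x))"
    unfolding drift_def by (simp add: linear_diff[OF lin] linear_neg[OF lin] linear_sum[OF lin] linear_scale[OF lin])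
  then show ?thesis using 1 by (simp add: algebra_simps add_divide_distrib)
qed

end

text \<open>Continuity of the first and second derivatives, and invertibility of the first, give bounds that are uniform near
  each point.\<close>

lemma (in hypersurface_patch) df_bounds:
  assumes x0: "x0 \<in> V"
  shows "\<exists>M>0. \<exists>K>0. \<exists>W. \<forall>\<^sub>F x in nhds x0. x \<in> V \<and> norm (f x) \<le> W \<and>
    (\<forall>v. norm (dird f v x) \<le> M * norm v \<and> norm v \<le> K * norm (dird f v x)) \<and>
    (\<forall>v w. norm (dird (dird f v) w x) \<le> W * norm v * norm w)"
proof -
  have lim: "(g \<longlongrightarrow> g x0) (nhds x0)" if "isCont g x0" for g :: "'a \<Rightarrow> 'z::topological_space"
    using that tendsto_at_iff_tendsto_nhds[of g x0] by (simp add: isCont_def)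
  define \<sigma> where "\<sigma> x = (\<Sum>i\<in>Basis. norm (dird f i x))" for x
  define \<tau> where "\<tau> x = (\<Sum>i\<in>Basis. norm (dird f i x - dird f i x0))" for x
  define \<omega> where "\<omega> x = (\<Sum>i\<in>Basis. \<Sum>j\<in>Basis. norm (dird (dird f i) j x))" for x
  have "isCont \<sigma> x0" "isCont \<tau> x0" "isCont \<omega> x0" "isCont (\<lambda>x. norm (f x)) x0"
    unfolding \<sigma>_def[abs_def] \<tau>_def[abs_def] \<omega>_def[abs_def]
    by (intro continuous_intros smooth_on_isCont[OF f x0] smooth_on_isCont[OF smooth_on_dird[OF f] x0]
        smooth_on_isCont[OF smooth_on_dird[OF smooth_on_dird[OF f]] x0])+
  note lims = this[THEN lim]
  define P where "P = (\<Sum>i\<in>Basis. norm (pull x0 i)) + 1"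
  have P: "P > 0" unfolding P_def by (intro add_nonneg_pos sum_nonneg) auto
  have P1: "norm (pull x0 z) \<le> P * norm z" for z
    using norm_linear_le_sum_Basis[OF linear_pull[OF x0], of z] norm_ge_zero[of z]
    unfolding P_def distrib_right by linarith
  have \<sigma>0: "\<sigma> x0 \<ge> 0" and \<omega>0: "\<omega> x0 \<ge> 0" by (simp_all add: \<sigma>_def \<omega>_def sum_nonneg)
  define W where "W = \<omega> x0 + norm (f x0) + 1"
  have "\<tau> x0 = 0" by (simp add: \<tau>_def)
  have "\<forall>\<^sub>F x in nhds x0. x \<in> V" using V x0 by (rule eventually_nhds_in_open)
  moreover have "\<forall>\<^sub>F x in nhds x0. \<sigma> x < \<sigma> x0 + 1" by (rule order_tendstoD(2)[OF lims(1)]) simp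
  moreover have "\<forall>\<^sub>F x in nhds x0. \<tau> x < 1 / (2 * P)"
    by (rule order_tendstoD(2)[OF lims(2)]) (use P \<open>\<tau> x0 = 0\<close> in simp)
  moreover have "\<forall>\<^sub>F x in nhds x0. \<omega> x < W"
    by (rule order_tendstoD(2)[OF lims(3)]) (simp add: W_def add_nonneg_pos)
  moreover have "\<forall>\<^sub>F x in nhds x0. norm (f x) < W"
    by (rule order_tendstoD(2)[OF lims(4)]) (use \<omega>0 in \<open>simp add: W_def\<close>)
  ultimately have "\<forall>\<^sub>F x in nhds x0. x \<in> V \<and> norm (f x) \<le> W \<and>
    (\<forall>v. norm (dird f v x) \<le> (\<sigma> x0 + 1) * norm v \<and> norm v \<le> (2 * P) * norm (dird f v x)) \<and>
    (\<forall>v w. norm (dird (dird f v) w x) \<le> W * norm v * norm w)"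
  proof eventually_elim
    case (elim x)
    show ?case
    proof (intro conjI allI)
      show "x \<in> V" "norm (f x) \<le> W" using elim by auto
      fix v w
      have "norm (dird f v x) \<le> \<sigma> x * norm v"
        unfolding \<sigma>_def by (rule norm_linear_le_sum_Basis[OF linear_df[OF elim(1)]])
      also have "\<dots> \<le> (\<sigma> x0 + 1) * norm v" using elim by (intro mult_right_mono) auto
      finally show "norm (dird f v x) \<le> (\<sigma> x0 + 1) * norm v" .
      have "norm (dird f v x - dird f v x0) \<le> \<tau> x * norm v"
        unfolding \<tau>_def
        by (rule norm_linear_le_sum_Basis[OF linear_compose_sub[OF linear_df[OF elim(1)] linear_df[OF x0]]])
      also have "\<dots> \<le> 1 / (2 * P) * norm v" using elim by (intro mult_right_mono) auto
      finally have 1: "norm (dird f v x - dird f v x0) \<le> 1 / (2 * P) * norm v" .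
      have "norm v \<le> P * norm (dird f v x0)" using P1[of "dird f v x0"] by (simp add: pull_df[OF x0])
      also have "\<dots> \<le> P * (norm (dird f v x) + 1 / (2 * P) * norm v)"
        using 1 norm_triangle_sub[of "dird f v x0" "dird f v x"] P
        by (intro mult_left_mono) (auto simp: norm_minus_commute)
      also have "\<dots> = P * norm (dird f v x) + norm v / 2" using P by (simp add: field_simps)
      finally show "norm v \<le> 2 * P * norm (dird f v x)" by simp
      have "norm (dird (dird f v) w x) \<le> (\<Sum>j\<in>Basis. norm (dird (dird f v) j x)) * norm w"
        by (rule norm_linear_le_sum_Basis[OF linear_ddf(1)[OF elim(1)]])
      also have "(\<Sum>j\<in>Basis. norm (dird (dird f v) j x))
          \<le> (\<Sum>j\<in>Basis. (\<Sum>i\<in>Basis. norm (dird (dird f i) j x)) * norm v)"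
        by (intro sum_mono norm_linear_le_sum_Basis[OF linear_ddf(2)[OF elim(1)]])
      also have "\<dots> = \<omega> x * norm v"
        unfolding \<omega>_def by (subst sum.swap) (simp add: sum_distrib_right)
      also have "\<dots> \<le> W * norm v" using elim by (intro mult_right_mono) auto
      finally show "norm (dird (dird f v) w x) \<le> W * norm v * norm w" by (simp add: mult_right_mono)
    qed
  qed
  then show ?thesis using \<sigma>0 P by (intro exI[of _ "\<sigma> x0 + 1"] exI[of _ "2 * P"] exI[of _ W] conjI) auto
qed

text \<open>The frames need not depend continuously on the point, so ellipticity cannot come from continuity of
  the coefficients. It comes from \<open>y = \<Sum>\<^sub>b \<langle>Df(y), b\<rangle> e\<^sub>b\<close> and the Cauchy-Schwarz inequality:
  \<open>|y|\<^sup>4 \<le> |Df(y)|\<^sup>2 \<Sum>\<^sub>b \<langle>y, e\<^sub>b\<rangle>\<^sup>2\<close>.\<close>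

lemma (in hypersurface_patch) elliptic:
  assumes frames: "\<And>x. x \<in> V \<Longrightarrow> frame x (Bf x)" and x0: "x0 \<in> V"
  shows "\<exists>r>0. \<exists>l>0. \<exists>C. \<forall>x\<in>V \<inter> ball x0 r.
        (\<forall>y. l * (norm y)^2 \<le> (\<Sum>b\<in>Bf x. (y \<bullet> pull x b)^2)) \<and>
        (\<Sum>b\<in>Bf x. (norm (pull x b))^2) \<le> C \<and> norm (drift \<alpha> x (Bf x)) \<le> C"
proof -
  obtain M K W where M: "M > 0" and K: "K > 0" and ev: "\<forall>\<^sub>F x in nhds x0. x \<in> V \<and> norm (f x) \<le> W \<and>
    (\<forall>v. norm (dird f v x) \<le> M * norm v \<and> norm v \<le> K * norm (dird f v x)) \<and>
    (\<forall>v w. norm (dird (dird f v) w x) \<le> W * norm v * norm w)"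
    using df_bounds[OF x0] by blast
  then obtain r where r: "r > 0" and near: "\<And>x. dist x x0 < r \<Longrightarrow> x \<in> V \<and> norm (f x) \<le> W \<and>
    (\<forall>v. norm (dird f v x) \<le> M * norm v \<and> norm v \<le> K * norm (dird f v x)) \<and>
    (\<forall>v w. norm (dird (dird f v) w x) \<le> W * norm v * norm w)"
    unfolding eventually_nhds_metric by blast
  have W0: "W \<ge> 0" using order_trans[OF norm_ge_zero, of "f x0" W] near[of x0] r by simp
  define C where "C = DIM('a) * K^2 + (DIM('a) * (K * (W * K * K)) + \<bar>\<alpha> / 2\<bar> * (K * W))"
  have C1: "DIM('a) * K^2 \<le> C" and C2: "DIM('a) * (K * (W * K * K)) + \<bar>\<alpha> / 2\<bar> * (K * W) \<le> C"
    using W0 K by (simp_all add: C_def)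
  have "(1 / M^2) * (norm y)^2 \<le> (\<Sum>b\<in>Bf x. (y \<bullet> pull x b)^2)"
    "(\<Sum>b\<in>Bf x. (norm (pull x b))^2) \<le> C" "norm (drift \<alpha> x (Bf x)) \<le> C"
    if xV: "x \<in> V" "dist x x0 < r" for x y
  proof -
    interpret patch_frame V f \<nu> x "Bf x" by standard (use xV frames in auto)
    have fW: "norm (f x) \<le> W" and dM: "\<And>v. norm (dird f v x) \<le> M * norm v"
      and dK: "\<And>v. norm v \<le> K * norm (dird f v x)"
      and ddW: "\<And>v w. norm (dird (dird f v) w x) \<le> W * norm v * norm w"
      using near[OF xV(2)] by auto
    have pullK: "norm (pull x z) \<le> K * norm z" for z
    proof -
      have "(norm (z - (z \<bullet> \<nu> x) *\<^sub>R \<nu> x))^2 = (norm z)^2 - (z \<bullet> \<nu> x)^2"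
        unfolding power2_norm_eq_inner
        by (simp add: inner_diff_left inner_diff_right \<nu>_inner_self[OF xV(1)] inner_commute power2_eq_square)
      then have "(norm (z - (z \<bullet> \<nu> x) *\<^sub>R \<nu> x))^2 \<le> (norm z)^2" by simp
      then have "norm (z - (z \<bullet> \<nu> x) *\<^sub>R \<nu> x) \<le> norm z" by (simp add: power_mono_iff)
      then show ?thesis
        using dK[of "pull x z"] K unfolding df_pull[OF xV(1)]
        by (meson less_imp_le mult_left_mono order_trans)
    qed
    have eK: "norm (e b) \<le> K" if "b \<in> Bf x" for b
      using pullK[of b] frame_unit[OF that] by (simp add: norm_eq_sqrt_inner)
    show "(\<Sum>b\<in>Bf x. (norm (pull x b))^2) \<le> C"
    proof -
      have "(\<Sum>b\<in>Bf x. (norm (e b))^2) \<le> card (Bf x) * K^2"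
        by (intro sum_bounded_above power_mono eK) auto
      then show ?thesis using C1 by (simp add: card_frame)
    qed
    show "(1 / M^2) * (norm y)^2 \<le> (\<Sum>b\<in>Bf x. (y \<bullet> pull x b)^2)"
    proof (cases "y = 0")
      case True then show ?thesis by (simp add: sum_nonneg)
    next
      case False
      define S where "S = (\<Sum>b\<in>Bf x. (y \<bullet> e b)^2)"
      have t: "dird f y x \<bullet> \<nu> x = 0" using normal[OF xV(1)] by (simp add: inner_commute)
      have "(norm y)^2 = y \<bullet> pull x (dird f y x)"
        by (simp add: pull_df[OF xV(1)] power2_norm_eq_inner)
      also have "\<dots> = (\<Sum>b\<in>Bf x. (dird f y x \<bullet> b) * (y \<bullet> e b))"
        by (simp add: pull_expand[OF t] inner_sum_right)
      finally have "((norm y)^2)^2 \<le> (\<Sum>b\<in>Bf x. (dird f y x \<bullet> b)^2) * S"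
        unfolding S_def by (metis (no_types) Cauchy_Schwarz_ineq_sum)
      also have "(\<Sum>b\<in>Bf x. (dird f y x \<bullet> b)^2) = (norm (dird f y x))^2"
        using norm_expand[OF t] by simp
      also have "(norm (dird f y x))^2 * S \<le> (M * norm y)^2 * S"
        by (intro mult_right_mono power_mono dM) (auto simp: S_def sum_nonneg)
      finally have "(norm y)^2 * (norm y)^2 \<le> (norm y)^2 * (M^2 * S)"
        by (simp add: power2_eq_square mult_ac)
      then have "(norm y)^2 \<le> M^2 * S" by (rule mult_left_le_imp_le) (use False in simp)
      then show ?thesis using M by (simp add: S_def field_simps)
    qed
    show "norm (drift \<alpha> x (Bf x)) \<le> C"
    proof -
      have "norm (\<Sum>b\<in>Bf x. pull x (dird (dird f (e b)) (e b) x)) \<le> (\<Sum>b\<in>Bf x. K * (W * K * K))"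
      proof (rule sum_norm_le)
        fix b assume b: "b \<in> Bf x"
        have "norm (dird (dird f (e b)) (e b) x) \<le> W * norm (e b) * norm (e b)" by (rule ddW)
        also have "\<dots> \<le> W * K * K" using eK[OF b] W0 K by (intro mult_mono) auto
        finally show "norm (pull x (dird (dird f (e b)) (e b) x)) \<le> K * (W * K * K)"
          using pullK K by (meson less_imp_le mult_left_mono order_trans)
      qed
      moreover have "norm ((\<alpha> / 2) *\<^sub>R pull x (f x)) \<le> \<bar>\<alpha> / 2\<bar> * (K * W)"
        unfolding norm_scaleR
        using order_trans[OF pullK mult_left_mono[OF fW]] K by (intro mult_left_mono) auto
      ultimately have "norm (drift \<alpha> x (Bf x)) \<le> DIM('a) * (K * (W * K * K)) + \<bar>\<alpha> / 2\<bar> * (K * W)"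
        unfolding drift_def
        by (intro order_trans[OF norm_triangle_ineq4] add_mono) (simp_all add: card_frame)
      then show ?thesis using C2 by linarith
    qed
  qed
  then show ?thesis using r M
    by (intro exI[of _ r] exI[of _ "1 / M^2"] exI[of _ C] conjI ballI allI) (auto simp: dist_commute)
qed


section \<open>Invariant geometry computed in charts\<close>

locale hypersurface =
  fixes \<A> :: "('a::euclidean_space, 'm::{t2_space, second_countable_topology}) atlas"
    and F N :: "'m \<Rightarrow> 'b::euclidean_space"
  assumes dim: "DIM('b) = DIM('a) + 1"
    and atlas: "smooth_atlas \<A>"
    and immersion: "immersion \<A> F"
    and unit_normal: "unit_normal_field \<A> F N"
begin

lemma chart_props:
  assumes "(V, \<psi>) \<in> \<A>"
  shows "open V" "open (\<psi> ` V)" "\<exists>\<phi>. homeomorphism V (\<psi> ` V) \<psi> \<phi>"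
  using atlas assms unfolding smooth_atlas_def by blast+

lemma chart_continuous:
  assumes "(V, \<psi>) \<in> \<A>"
  shows "continuous_on V \<psi>" "inj_on \<psi> V"
proof -
  obtain \<phi> where h: "homeomorphism V (\<psi> ` V) \<psi> \<phi>" using chart_props(3)[OF assms] by blast
  show "continuous_on V \<psi>" by (rule homeomorphism_cont1[OF h])
  show "inj_on \<psi> V" by (rule inj_on_inverseI[where g = \<phi>]) (rule homeomorphism_apply1[OF h])
qed

lemma chart_open_image:
  assumes "(V, \<psi>) \<in> \<A>" "open U" "U \<subseteq> V"
  shows "open (\<psi> ` U)"
proof -
  obtain \<phi> where h: "homeomorphism V (\<psi> ` V) \<psi> \<phi>" using chart_props(3)[OF assms(1)] by blast
  have "openin (top_of_set (\<psi> ` V)) (\<psi> ` U)"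
    using homeomorphism_imp_open_map[OF h] assms(2,3) by (simp add: open_subset)
  then show ?thesis using chart_props(2)[OF assms(1)] openin_open_trans by blast
qed

lemma chart_at: obtains V \<psi> u where "(V, \<psi>) \<in> \<A>" "u \<in> V" "p = \<psi> u"
proof -
  have "(\<Union>(V, \<psi>)\<in>\<A>. \<psi> ` V) = UNIV" using atlas unfolding smooth_atlas_def by (elim conjE)
  then have "p \<in> (\<Union>c\<in>\<A>. case c of (V, \<psi>) \<Rightarrow> \<psi> ` V)" by simp
  then obtain c where c: "c \<in> \<A>" "p \<in> (case c of (V, \<psi>) \<Rightarrow> \<psi> ` V)" by (rule UN_E)
  then obtain u where "u \<in> fst c" "p = snd c u" unfolding split_beta by (rule_tac imageE)
  then show ?thesis using that[of "fst c" "snd c" u] c by simp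
qed

lemma smooth_map_chart: "smooth_map \<A> G \<Longrightarrow> (V, \<psi>) \<in> \<A> \<Longrightarrow> smooth_on (G \<circ> \<psi>) V"
  unfolding smooth_map_def by blast

lemma smooth_maps: "smooth_map \<A> F" "smooth_map \<A> N"
  using immersion unit_normal unfolding immersion_def unit_normal_field_def by (simp_all only:)

lemma smooth_map_continuous:
  assumes G: "smooth_map \<A> G"
  shows "continuous_on UNIV G"
proof -
  have "isCont G p" for p
  proof -
    obtain V \<psi> u where c: "(V, \<psi>) \<in> \<A>" "u \<in> V" "p = \<psi> u" by (rule chart_at)
    obtain \<phi> where h: "homeomorphism V (\<psi> ` V) \<psi> \<phi>" using chart_props(3)[OF c(1)] by blast
    have "continuous_on V (G \<circ> \<psi>)"
      using smooth_on_isCont[OF smooth_map_chart[OF G c(1)]] continuous_at_imp_continuous_on by blast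
    then have "continuous_on (\<psi> ` V) (\<lambda>q. (G \<circ> \<psi>) (\<phi> q))"
      by (rule continuous_on_compose2[OF _ homeomorphism_cont2[OF h]])
         (use homeomorphism_image2[OF h] in auto)
    then have "continuous_on (\<psi> ` V) G"
      by (rule continuous_on_eq) (use homeomorphism_apply1[OF h] in auto)
    then show ?thesis
      using c chart_props(2)[OF c(1)] continuous_on_eq_continuous_at by blast
  qed
  then show ?thesis by (simp add: continuous_at_imp_continuous_on)
qed

lemma param_at_props:
  "param_at \<A> p \<in> \<A>" "coord_at \<A> p \<in> fst (param_at \<A> p)" "snd (param_at \<A> p) (coord_at \<A> p) = p"
proof -
  obtain V \<psi> u where "(V, \<psi>) \<in> \<A>" "u \<in> V" "p = \<psi> u" by (rule chart_at)
  then have "\<exists>c. case c of (V, \<psi>) \<Rightarrow> (V, \<psi>) \<in> \<A> \<and> p \<in> \<psi> ` V"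
    by (intro exI[of _ "(V, \<psi>)"]) auto
  then have *: "case param_at \<A> p of (V, \<psi>) \<Rightarrow> (V, \<psi>) \<in> \<A> \<and> p \<in> \<psi> ` V"
    unfolding param_at_def by (rule someI_ex)
  then show "param_at \<A> p \<in> \<A>" "coord_at \<A> p \<in> fst (param_at \<A> p)"
    "snd (param_at \<A> p) (coord_at \<A> p) = p"
    unfolding coord_at_def by (auto simp: split_beta inv_into_into f_inv_into_f)
qed

text \<open>The change of coordinates from \<open>\<psi>\<close> to the parametrization chosen at \<open>p\<close>.\<close>

definition transition :: "('a \<Rightarrow> 'm) \<Rightarrow> 'm \<Rightarrow> 'a \<Rightarrow> 'a" where
  "transition \<psi> p u = inv_into (fst (param_at \<A> p)) (snd (param_at \<A> p)) (\<psi> u)"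

text \<open>Tangent spaces, the second fundamental form and the mean curvature at \<open>p\<close> are defined in a chart chosen at
  \<open>p\<close>, which changes with \<open>p\<close>. First derivatives in any other chart differ by the same linear map for all smooth
  functions, and this suffices: paired with the normal, the second fundamental form is \<open>- \<langle>Y, DN(X)\<rangle>\<close>,
  which involves no second derivatives.\<close>

lemma dird_change_of_chart:
  assumes c: "(V, \<psi>) \<in> \<A>" "u \<in> V" and G: "smooth_map \<A> G"
  shows "dird (G \<circ> \<psi>) v u =
    dird (local_rep \<A> G (\<psi> u)) (dird (transition \<psi> (\<psi> u)) v u) (coord_at \<A> (\<psi> u))"
    and "linear (\<lambda>v. dird (transition \<psi> (\<psi> u)) v u)"
proof -
  define W \<eta> where "W = fst (param_at \<A> (\<psi> u))" and "\<eta> = snd (param_at \<A> (\<psi> u))"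
  have W: "(W, \<eta>) \<in> \<A>" and cW: "coord_at \<A> (\<psi> u) \<in> W" "\<eta> (coord_at \<A> (\<psi> u)) = \<psi> u"
    using param_at_props[of "\<psi> u"] by (simp_all add: W_def \<eta>_def)
  define \<tau> where "\<tau> = transition \<psi> (\<psi> u)"
  have \<tau>: "\<tau> u' = inv_into W \<eta> (\<psi> u')" for u' by (simp add: \<tau>_def transition_def W_def \<eta>_def)
  let ?S = "V \<inter> \<psi> -` (\<eta> ` W)"
  have S: "open ?S"
    using chart_continuous(1)[OF c(1)] chart_props(1)[OF c(1)] chart_props(2)[OF W]
    by (rule continuous_open_preimage)
  have uS: "u \<in> ?S" using c(2) cW by (metis IntI image_eqI vimageI2)
  have "smooth_on (\<lambda>u. inv_into W \<eta> (\<psi> u)) ?S"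
    using atlas c(1) W unfolding smooth_atlas_def by blast
  moreover have "\<tau> = (\<lambda>u. inv_into W \<eta> (\<psi> u))" by (rule ext) (rule \<tau>)
  ultimately have sm: "smooth_on \<tau> ?S" by simp
  show "linear (\<lambda>v. dird (transition \<psi> (\<psi> u)) v u)"
    using linear_dird[OF sm uS] by (simp add: \<tau>_def)
  have \<tau>u: "\<tau> u = coord_at \<A> (\<psi> u)"
    unfolding \<tau> coord_at_def W_def \<eta>_def by (simp add: split_beta)
  have "((\<lambda>x. (G \<circ> \<eta>) (\<tau> x)) has_derivative (\<lambda>v. dird (G \<circ> \<eta>) (dird \<tau> v u) (\<tau> u))) (at u)"
    by (rule has_derivative_compose[where f = \<tau> and g = "G \<circ> \<eta>", OF smooth_on_has_derivative[OF sm uS]])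
       (use smooth_on_has_derivative[OF smooth_map_chart[OF G W] cW(1)] in \<open>simp only: \<tau>u\<close>)
  then have "((G \<circ> \<psi>) has_derivative (\<lambda>v. dird (G \<circ> \<eta>) (dird \<tau> v u) (\<tau> u))) (at u)"
    by (rule has_derivative_transform_within_open[OF _ S uS]) (auto simp: \<tau> f_inv_into_f)
  then show "dird (G \<circ> \<psi>) v u =
    dird (local_rep \<A> G (\<psi> u)) (dird (transition \<psi> (\<psi> u)) v u) (coord_at \<A> (\<psi> u))"
    using dird_eqI[of "G \<circ> \<psi>" _ u v] unfolding \<tau>u by (simp add: local_rep_def \<eta>_def \<tau>_def)
qed

lemma inj_dF:
  assumes "(V, \<psi>) \<in> \<A>" "u \<in> V"
  shows "inj (\<lambda>v. dird (F \<circ> \<psi>) v u)"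
proof -
  have "inj (frechet_derivative (F \<circ> \<psi>) (at u))" using immersion assms unfolding immersion_def by blast
  then show ?thesis unfolding dird_def .
qed

lemma tangent_space_chart:
  assumes c: "(V, \<psi>) \<in> \<A>" "u \<in> V"
  shows "tangent_space \<A> F (\<psi> u) = range (\<lambda>v. dird (F \<circ> \<psi>) v u)"
proof -
  let ?L = "\<lambda>v. dird (transition \<psi> (\<psi> u)) v u"
  note ch = dird_change_of_chart[OF c smooth_maps(1)]
  have "inj ?L"
  proof (rule injI)
    fix v w assume "?L v = ?L w"
    then have "dird (F \<circ> \<psi>) v u = dird (F \<circ> \<psi>) w u" by (simp add: ch(1))
    then show "v = w" using inj_dF[OF c] by (simp add: inj_def)
  qed
  then have "surj ?L" using linear_injective_imp_surjective[OF ch(2)] by simp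
  then have "range (\<lambda>v. dird (F \<circ> \<psi>) v u) = range (\<lambda>v. dird (local_rep \<A> F (\<psi> u)) v (coord_at \<A> (\<psi> u)))"
    unfolding ch(1) using \<open>surj ?L\<close> image_image[of "\<lambda>v. dird (local_rep \<A> F (\<psi> u)) v (coord_at \<A> (\<psi> u))" ?L UNIV] by simp
  then show ?thesis unfolding tangent_space_def dird_def by simp
qed

lemma patch:
  assumes c: "(V, \<psi>) \<in> \<A>"
  shows "hypersurface_patch V (F \<circ> \<psi>) (N \<circ> \<psi>)"
proof
  show "(N \<circ> \<psi>) x \<bullet> dird (F \<circ> \<psi>) v x = 0" if x: "x \<in> V" for x v
  proof -
    have "dird (F \<circ> \<psi>) v x \<in> tangent_space \<A> F (\<psi> x)" using tangent_space_chart[OF c x] by blast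
    then show ?thesis using unit_normal unfolding unit_normal_field_def orthogonal_def by simp
  qed
  show "norm ((N \<circ> \<psi>) x) = 1" for x using unit_normal by (simp add: unit_normal_field_def)
qed (use dim chart_props[OF c] smooth_map_chart[OF _ c] smooth_maps inj_dF[OF c] in auto)

lemma tangent_space_eq: "tangent_space \<A> F p = {z. N p \<bullet> z = 0}"
proof -
  obtain V \<psi> u where c: "(V, \<psi>) \<in> \<A>" "u \<in> V" and p: "p = \<psi> u" by (rule chart_at)
  interpret hypersurface_patch V "F \<circ> \<psi>" "N \<circ> \<psi>" by (rule patch[OF c(1)])
  show ?thesis unfolding p tangent_space_chart[OF c] using range_df[OF c(2)] by simp
qed

lemma N_unit: "N p \<bullet> N p = 1"
  using unit_normal by (simp add: unit_normal_field_def norm_eq_1)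

lemma tangential_part_eq: "tangential_part \<A> F p z = z - (z \<bullet> N p) *\<^sub>R N p"
  unfolding tangential_part_def tangent_space_eq
proof (rule the_equality)
  show "z - (z \<bullet> N p) *\<^sub>R N p \<in> {z. N p \<bullet> z = 0} \<and>
    (\<forall>za\<in>{z. N p \<bullet> z = 0}. orthogonal (z - (z - (z \<bullet> N p) *\<^sub>R N p)) za)"
    by (auto simp: inner_diff_right N_unit inner_commute orthogonal_def)
  fix y assume y: "y \<in> {z. N p \<bullet> z = 0} \<and> (\<forall>za\<in>{z. N p \<bullet> z = 0}. orthogonal (z - y) za)"
  let ?d = "z - (z \<bullet> N p) *\<^sub>R N p - y"
  have Nd: "N p \<bullet> ?d = 0" using y by (simp add: inner_diff_right N_unit inner_commute)
  then have "(z - y) \<bullet> ?d = 0" using y unfolding orthogonal_def by simp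
  moreover have "z - y = ?d + (z \<bullet> N p) *\<^sub>R N p" by simp
  ultimately have "?d \<bullet> ?d = 0" using Nd by (simp only: inner_add_left inner_scaleR_left mult_zero_right add_0_right)
  then show "y = z - (z \<bullet> N p) *\<^sub>R N p" by simp
qed

lemma normal_part_eq: "normal_part \<A> F p z = (z \<bullet> N p) *\<^sub>R N p"
  by (simp add: normal_part_def tangential_part_eq)

lemma second_fundamental_form_chart:
  assumes c: "(V, \<psi>) \<in> \<A>" "u \<in> V"
  shows "second_fundamental_form \<A> F (\<psi> u) (dird (F \<circ> \<psi>) v u) (dird (F \<circ> \<psi>) w u)
    = - (dird (F \<circ> \<psi>) w u \<bullet> dird (N \<circ> \<psi>) v u) *\<^sub>R N (\<psi> u)"
proof -
  define W \<eta> u0 where "W = fst (param_at \<A> (\<psi> u))" and "\<eta> = snd (param_at \<A> (\<psi> u))"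
    and "u0 = coord_at \<A> (\<psi> u)"
  have W: "(W, \<eta>) \<in> \<A>" and u0: "u0 \<in> W" "\<eta> u0 = \<psi> u"
    using param_at_props[of "\<psi> u"] by (simp_all add: W_def \<eta>_def u0_def)
  interpret P: hypersurface_patch W "F \<circ> \<eta>" "N \<circ> \<eta>" by (rule patch[OF W])
  let ?L = "\<lambda>v. dird (transition \<psi> (\<psi> u)) v u"
  have F1: "dird (F \<circ> \<psi>) v u = dird (F \<circ> \<eta>) (?L v) u0" for v
    using dird_change_of_chart(1)[OF c smooth_maps(1)] by (simp add: local_rep_def \<eta>_def u0_def)
  have N1: "dird (N \<circ> \<psi>) v u = dird (N \<circ> \<eta>) (?L v) u0" for v
    using dird_change_of_chart(1)[OF c smooth_maps(2)] by (simp add: local_rep_def \<eta>_def u0_def)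
  have inv: "inv (frechet_derivative (F \<circ> \<eta>) (at u0)) (dird (F \<circ> \<eta>) v u0) = v" for v
    using inv_f_f[OF P.inj_dird[OF u0(1)], of v] unfolding dird_def by simp
  have "second_fundamental_form \<A> F (\<psi> u) (dird (F \<circ> \<eta>) v u0) (dird (F \<circ> \<eta>) w u0)
     = normal_part \<A> F (\<psi> u) (dird (dird (F \<circ> \<eta>) w) v u0)" for v w
    unfolding second_fundamental_form_def
    by (simp add: local_rep_def Let_def inv flip: \<eta>_def u0_def) (simp add: dird_def[abs_def])
  then show ?thesis
    unfolding F1 N1 normal_part_eq using P.ddf_\<nu>[OF u0(1)] u0(2) by simp
qed

lemma orthonormal_frame_chart:
  assumes c: "(V, \<psi>) \<in> \<A>" "u \<in> V"
  shows "hypersurface_patch.frame (F \<circ> \<psi>) u (orthonormal_frame \<A> F (\<psi> u))"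
proof -
  interpret hypersurface_patch V "F \<circ> \<psi>" "N \<circ> \<psi>" by (rule patch[OF c(1)])
  have "subspace (tangent_space \<A> F (\<psi> u))" unfolding tangent_space_eq by (rule subspace_hyperplane)
  then have "\<exists>B. pairwise orthogonal B \<and> (\<forall>e\<in>B. norm e = 1) \<and> span B = tangent_space \<A> F (\<psi> u)"
    by (metis orthonormal_basis_subspace)
  then have "pairwise orthogonal (orthonormal_frame \<A> F (\<psi> u)) \<and>
    (\<forall>e\<in>orthonormal_frame \<A> F (\<psi> u). norm e = 1) \<and>
    span (orthonormal_frame \<A> F (\<psi> u)) = tangent_space \<A> F (\<psi> u)"
    unfolding orthonormal_frame_def by (rule someI_ex)
  then show ?thesis unfolding frame_def tangent_space_chart[OF c] .
qed

context
  fixes V \<psi> u assumes c: "(V, \<psi>) \<in> \<A>" "u \<in> V"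
begin

interpretation P: hypersurface_patch V "F \<circ> \<psi>" "N \<circ> \<psi>" by (rule patch[OF c(1)])

interpretation PF: patch_frame V "F \<circ> \<psi>" "N \<circ> \<psi>" u "orthonormal_frame \<A> F (\<psi> u)"
  by standard (use c orthonormal_frame_chart in auto)

lemma patch_frame: "patch_frame V (F \<circ> \<psi>) (N \<circ> \<psi>) u (orthonormal_frame \<A> F (\<psi> u))"
  by unfold_locales

lemma sff_frame:
  assumes "b \<in> orthonormal_frame \<A> F (\<psi> u)" "b' \<in> orthonormal_frame \<A> F (\<psi> u)"
  shows "second_fundamental_form \<A> F (\<psi> u) b b' = - (b' \<bullet> dird (N \<circ> \<psi>) (P.pull u b) u) *\<^sub>R N (\<psi> u)"
  using second_fundamental_form_chart[OF c, of "P.pull u b" "P.pull u b'"] assms by (simp add: PF.df_e)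

lemma mean_curvature_chart: "mean_curvature \<A> F N (\<psi> u) = P.mc u"
  unfolding mean_curvature_def mean_curvature_vector_def PF.mc_frame
  by (simp add: inner_sum_left sff_frame N_unit sum_negf)

lemma norm_sq_sff_chart: "norm_sq_sff \<A> F (\<psi> u) = PF.norm_sq_A"
proof -
  have "(\<Sum>b'\<in>orthonormal_frame \<A> F (\<psi> u). (norm (second_fundamental_form \<A> F (\<psi> u) b b'))\<^sup>2)
     = (norm (dird (N \<circ> \<psi>) (P.pull u b) u))^2" if b: "b \<in> orthonormal_frame \<A> F (\<psi> u)" for b
  proof -
    have "norm (N (\<psi> u)) = 1" using N_unit by (simp add: norm_eq_1)
    then show ?thesis
      unfolding PF.norm_expand[OF P.d\<nu>_\<nu>[OF c(2)]]
      using b by (intro sum.cong refl) (simp add: sff_frame inner_commute)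
  qed
  then show ?thesis unfolding norm_sq_sff_def PF.norm_sq_A_def by simp
qed

lemma scalar_sff_position:
  "scalar_sff \<A> F N (\<psi> u) (tangential_part \<A> F (\<psi> u) (F (\<psi> u))) (tangential_part \<A> F (\<psi> u) (F (\<psi> u)))
    = 2 * P.h' u (P.pull u (F (\<psi> u)))"
proof -
  have "tangential_part \<A> F (\<psi> u) (F (\<psi> u)) = dird (F \<circ> \<psi>) (P.pull u (F (\<psi> u))) u"
    by (simp add: tangential_part_eq P.df_pull[OF c(2)])
  then have "scalar_sff \<A> F N (\<psi> u) (tangential_part \<A> F (\<psi> u) (F (\<psi> u))) (tangential_part \<A> F (\<psi> u) (F (\<psi> u)))
     = - (dird (F \<circ> \<psi>) (P.pull u (F (\<psi> u))) u \<bullet> dird (N \<circ> \<psi>) (P.pull u (F (\<psi> u))) u)"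
    unfolding scalar_sff_def by (simp add: second_fundamental_form_chart[OF c] N_unit)
  also have "\<dots> = - (F (\<psi> u) \<bullet> dird (N \<circ> \<psi>) (P.pull u (F (\<psi> u))) u)"
    using P.d\<nu>_\<nu>[OF c(2)] by (simp add: P.df_pull[OF c(2)] inner_diff_left inner_commute)
  finally show ?thesis by (simp add: P.h'_def)
qed

end

end


section \<open>The mean curvature of a pinched self-expander vanishes\<close>

text \<open>The sublevel set of \<open>G\<close> through a point lies over a bounded set, hence in a compact set.\<close>

lemma coercive_attains_min:
  fixes F :: "'m::topological_space \<Rightarrow> 'b::euclidean_space" and G :: "'m \<Rightarrow> real"
  assumes F: "proper_map_into F" and G: "continuous_on UNIV G"
    and \<epsilon>: "\<epsilon> > 0" and coercive: "\<And>p. c + \<epsilon> * (norm (F p))^2 \<le> G p"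
  shows "\<exists>q. \<forall>p. G q \<le> G p"
proof -
  fix p0 :: 'm
  define R where "R = sqrt ((G p0 - c) / \<epsilon>)"
  have R: "norm (F p) \<le> R" if "G p \<le> G p0" for p
  proof -
    have "(norm (F p))^2 \<le> (G p0 - c) / \<epsilon>"
      using coercive[of p] that \<epsilon> by (simp add: pos_le_divide_eq mult.commute)
    then show ?thesis unfolding R_def by (rule real_le_rsqrt)
  qed
  have "compact (F -` cball 0 R)" using F unfolding proper_map_into_def by simp
  moreover have ne: "p0 \<in> F -` cball 0 R" using R[of p0] by simp
  moreover from ne have "F -` cball 0 R \<noteq> {}" by blast
  moreover have "continuous_on (F -` cball 0 R) G" using continuous_on_subset[OF G] by blast
  ultimately obtain q where q: "\<And>p. p \<in> F -` cball 0 R \<Longrightarrow> G q \<le> G p"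
    using continuous_attains_inf[of "F -` cball 0 R" G] by blast
  have "G q \<le> G p" for p
  proof (cases "G p \<le> G p0")
    case True then show ?thesis using R[of p] by (intro q) simp
  next
    case False
    have "G q \<le> G p0" using \<open>p0 \<in> F -` cball 0 R\<close> by (rule q)
    then show ?thesis using False by simp
  qed
  then show ?thesis by blast
qed

locale proper_expander = hypersurface \<A> F N
  for \<A> :: "('a::euclidean_space, 'm::{t2_space, second_countable_topology}) atlas"
    and F N :: "'m \<Rightarrow> 'b::euclidean_space" +
  assumes connected: "connected (UNIV :: 'm set)"
    and proper: "proper_map_into F"
    and expander: "self_expander \<A> F"
begin

definition H :: "'m \<Rightarrow> real" where "H p = mean_curvature \<A> F N p"

lemma H_eq: "H p = - (F p \<bullet> N p) / 2"
  using expander unfolding H_def mean_curvature_def self_expander_def normal_part_eq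
  by (simp add: N_unit)

lemma continuous_F: "continuous_on UNIV F" and continuous_N: "continuous_on UNIV N"
  by (rule smooth_map_continuous[OF smooth_maps(1)], rule smooth_map_continuous[OF smooth_maps(2)])

lemma continuous_H: "continuous_on UNIV H"
  unfolding H_eq[abs_def] by (intro continuous_intros continuous_F continuous_N) simp

lemma H_chart:
  assumes "(V, \<psi>) \<in> \<A>"
  shows "H (\<psi> u) = hypersurface_patch.h (F \<circ> \<psi>) (N \<circ> \<psi>) u"
proof -
  interpret P: hypersurface_patch V "F \<circ> \<psi>" "N \<circ> \<psi>" by (rule patch[OF assms])
  show ?thesis by (simp add: H_eq P.h_def)
qed

lemma expander_frame:
  assumes c: "(V, \<psi>) \<in> \<A>" "u \<in> V"
  shows "expander_frame V (F \<circ> \<psi>) (N \<circ> \<psi>) u (orthonormal_frame \<A> F (\<psi> u))"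
proof -
  interpret P: patch_frame V "F \<circ> \<psi>" "N \<circ> \<psi>" u "orthonormal_frame \<A> F (\<psi> u)"
    by (rule patch_frame[OF c])
  show ?thesis
  proof
    show "P.mc y = P.h y" if "y \<in> V" for y
      using mean_curvature_chart[OF c(1) that] H_chart[OF c(1), of y] by (simp add: H_def)
  qed
qed

end

locale pinched_expander = proper_expander \<A> F N
  for \<A> :: "('a::euclidean_space, 'm::{t2_space, second_countable_topology}) atlas"
    and F N :: "'m \<Rightarrow> 'b::euclidean_space" +
  fixes a b c \<alpha> :: real
  assumes lower: "\<And>p. c \<le> H p"
    and a: "0 \<le> a" "a < 1/2"
    and upper: "\<And>p. H p \<le> a * norm (F p) + b"
    and \<alpha>: "\<alpha> > 4 * a\<^sup>2 / (1 - 4 * a\<^sup>2)"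
    and pinching: "\<And>p. norm_sq_sff \<A> F p * H p + H p / 2
      + (\<alpha> + 1) / 4 * scalar_sff \<A> F N p (tangential_part \<A> F p (F p)) (tangential_part \<A> F p (F p)) \<ge> 0"
begin

text \<open>By \<open>\<langle>x\<^sup>T, \<nabla>H\<rangle> = A(x\<^sup>T, x\<^sup>T) / 2\<close> the left-hand side is minus the expression in the pinching condition.\<close>

lemma H_supersolution:
  assumes c: "(V, \<psi>) \<in> \<A>" "u \<in> V"
  defines "B \<equiv> orthonormal_frame \<A> F (\<psi> u)"
  shows "(\<Sum>b\<in>B. hypersurface_patch.h'' (F \<circ> \<psi>) (N \<circ> \<psi>) u
            (hypersurface_patch.pull (F \<circ> \<psi>) (N \<circ> \<psi>) u b) (hypersurface_patch.pull (F \<circ> \<psi>) (N \<circ> \<psi>) u b))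
      + hypersurface_patch.h' (F \<circ> \<psi>) (N \<circ> \<psi>) u
          (hypersurface_patch.drift (F \<circ> \<psi>) (N \<circ> \<psi>) \<alpha> u B) \<le> 0"
proof -
  interpret P: expander_frame V "F \<circ> \<psi>" "N \<circ> \<psi>" u B
    unfolding B_def by (rule expander_frame[OF c])
  show ?thesis
    unfolding P.h_operator
    using pinching[of "\<psi> u"] norm_sq_sff_chart[OF c] scalar_sff_position[OF c] H_chart[OF c(1), of u]
    by (simp add: B_def field_simps)
qed

text \<open>The expression is \<open>L|x|\<^sup>2\<close>. By the bounds on \<open>H\<close> it is at most a quadratic polynomial in \<open>|x|\<close> with
  leading coefficient \<open>4(1 + \<alpha>)a\<^sup>2 - \<alpha>\<close>, and this is negative exactly when \<open>\<alpha> > 4a\<^sup>2 / (1 - 4a\<^sup>2)\<close>.\<close>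

lemma drift_laplacian_negative_at_infinity:
  obtains R where "\<And>p. norm (F p) > R \<Longrightarrow>
    2 * DIM('a) + 4 * (1 + \<alpha>) * (H p)^2 - \<alpha> * (norm (F p))^2 < 0"
proof -
  have a4: "4 * a^2 < 1"
  proof -
    have "a^2 < (1/2)^2" using a by (intro power_strict_mono) auto
    then show ?thesis by (simp add: power_divide)
  qed
  then have \<alpha>1: "4 * a^2 < \<alpha> * (1 - 4 * a^2)" using \<alpha> by (simp add: pos_divide_less_eq)
  have \<alpha>0: "\<alpha> > 0"
  proof (rule ccontr)
    assume "\<not> \<alpha> > 0"
    then have "\<alpha> * (1 - 4 * a^2) \<le> 0" using a4 by (simp add: mult_nonpos_nonneg)
    then show False using \<alpha>1 zero_le_power2[of a] by linarith
  qed
  define \<delta> where "\<delta> = \<alpha> - 4 * (1 + \<alpha>) * a^2"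
  have \<delta>: "\<delta> > 0" using \<alpha>1 by (simp add: \<delta>_def algebra_simps)
  define A where "A = 8 * (1 + \<alpha>) * a * \<bar>b\<bar>"
  define C where "C = 2 * DIM('a) + 4 * (1 + \<alpha>) * (b^2 + c^2)"
  have AC: "A \<ge> 0" "C \<ge> 0" using a \<alpha>0 by (simp_all add: A_def C_def)
  show ?thesis
  proof (rule that[of "(A + C) / \<delta> + 1"])
    fix p assume p: "norm (F p) > (A + C) / \<delta> + 1"
    define r where "r = norm (F p)"
    have r1: "r > 1"
    proof -
      have "(A + C) / \<delta> \<ge> 0" using AC \<delta> by simp
      then show ?thesis using p by (simp add: r_def)
    qed
    have "(A + C) / \<delta> < r" using p by (simp add: r_def)
    then have "A + C < \<delta> * r" using \<delta> by (simp add: pos_divide_less_eq mult.commute)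
    then have 1: "(A + C) * r < \<delta> * r^2" using r1 by (simp add: power2_eq_square)
    have "C \<le> C * r" using AC r1 by (simp add: mult_le_cancel_left1)
    then have 2: "A * r + C < \<delta> * r^2" using 1 by (simp add: distrib_right)
    have H2: "(H p)^2 \<le> (a * r + \<bar>b\<bar>)^2 + c^2"
    proof (cases "H p \<ge> 0")
      case True
      then have "(H p)^2 \<le> (a * r + \<bar>b\<bar>)^2" using upper[of p] by (intro power_mono) (auto simp: r_def)
      then show ?thesis using zero_le_power2[of c] by linarith
    next
      case False
      then have "(- H p)^2 \<le> (- c)^2" using lower[of p] by (intro power_mono) auto
      then show ?thesis using zero_le_power2[of "a * r + \<bar>b\<bar>"] unfolding power2_minus by linarith
    qed
    have "4 * (1 + \<alpha>) * (H p)^2 \<le> 4 * (1 + \<alpha>) * ((a * r + \<bar>b\<bar>)^2 + c^2)"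
      using H2 \<alpha>0 by (intro mult_left_mono) auto
    also have "\<dots> = (\<alpha> - \<delta>) * r^2 + A * r + (C - 2 * DIM('a))"
      by (simp add: \<delta>_def A_def C_def power2_sum power_mult_distrib algebra_simps)
    finally show "2 * DIM('a) + 4 * (1 + \<alpha>) * (H p)^2 - \<alpha> * (norm (F p))^2 < 0"
      using 2 by (simp add: r_def[symmetric] algebra_simps)
  qed
qed

text \<open>Choose \<open>p0\<close> minimal for \<open>H\<close> on the compact set \<open>K\<close> outside of which \<open>L|x|\<^sup>2 < 0\<close>. For every \<open>\<epsilon> > 0\<close>
  the function \<open>H + \<epsilon>|x|\<^sup>2\<close> attains its minimum, and by the second derivative test it does so inside \<open>K\<close>;
  hence \<open>H p0 \<le> H + \<epsilon>|x|\<^sup>2\<close> everywhere.\<close>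

lemma H_attains_min: "\<exists>p0. \<forall>p. H p0 \<le> H p"
proof -
  obtain R where R: "\<And>p. norm (F p) > R \<Longrightarrow>
    2 * DIM('a) + 4 * (1 + \<alpha>) * (H p)^2 - \<alpha> * (norm (F p))^2 < 0"
    using drift_laplacian_negative_at_infinity by blast
  fix p1 :: 'm
  \<comment> \<open>The maximum makes sure that the compact set is nonempty.\<close>
  define K where "K = F -` cball 0 (max R (norm (F p1)))"
  have "compact K" using proper unfolding proper_map_into_def K_def by simp
  moreover have "p1 \<in> K" by (simp add: K_def)
  moreover from this have "K \<noteq> {}" by blast
  moreover have "continuous_on K H" using continuous_on_subset[OF continuous_H] by blast
  ultimately obtain p0 where p0: "\<And>p. p \<in> K \<Longrightarrow> H p0 \<le> H p"
    using continuous_attains_inf[of K H] by blast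
  have le: "H p0 \<le> H p + \<epsilon> * (norm (F p))^2" if \<epsilon>: "\<epsilon> > 0" for p \<epsilon>
  proof -
    define G where "G p = H p + \<epsilon> * (norm (F p))^2" for p
    have "\<exists>q. \<forall>p. G q \<le> G p"
    proof (rule coercive_attains_min[OF proper _ \<epsilon>])
      show "continuous_on UNIV G"
        unfolding G_def[abs_def] by (intro continuous_intros continuous_H continuous_F)
      show "c + \<epsilon> * (norm (F p))^2 \<le> G p" for p using lower by (simp add: G_def)
    qed
    then obtain q where q: "\<And>p. G q \<le> G p" by blast
    have "norm (F q) \<le> R"
    proof (rule ccontr)
      assume far: "\<not> norm (F q) \<le> R"
      obtain V \<psi> u where c: "(V, \<psi>) \<in> \<A>" "u \<in> V" and qu: "q = \<psi> u" by (rule chart_at)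
      define B where "B = orthonormal_frame \<A> F (\<psi> u)"
      interpret P: expander_frame V "F \<circ> \<psi>" "N \<circ> \<psi>" u B
        unfolding B_def by (rule expander_frame[OF c])
      define \<zeta> where "\<zeta> y = P.h y + \<epsilon> * (F (\<psi> y) \<bullet> F (\<psi> y))" for y
      define \<zeta>' where "\<zeta>' y v = P.h' y v + \<epsilon> * P.r2' y v" for y v
      define \<zeta>'' where "\<zeta>'' v w = P.h'' u v w + \<epsilon> * P.r2'' u v w" for v w
      have d1: "(\<zeta> has_derivative \<zeta>' y) (at y)" if "y \<in> V" for y
        unfolding \<zeta>_def[abs_def] \<zeta>'_def[abs_def]
        using P.r2_has_derivative[OF that]
        by (intro has_derivative_add has_derivative_mult_right P.h_has_derivative that) simp
      have d2: "((\<lambda>y. \<zeta>' y v) has_derivative \<zeta>'' v) (at u)" for v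
        unfolding \<zeta>'_def[abs_def] \<zeta>''_def[abs_def]
        by (intro has_derivative_add has_derivative_mult_right P.h'_has_derivative P.r2'_has_derivative c)
      have G\<zeta>: "\<zeta> y = G (\<psi> y)" if "y \<in> V" for y
        using H_chart[OF c(1), of y] by (simp add: \<zeta>_def G_def power2_norm_eq_inner)
      have tests: "\<zeta>' u v = 0" "0 \<le> \<zeta>'' v v" for v
        using local_min_derivative_tests[OF P.V c(2) d1 d2] q G\<zeta> c(2) qu by auto
      have "0 \<le> (\<Sum>b\<in>B. \<zeta>'' (P.pull u b) (P.pull u b)) + \<zeta>' u (P.drift \<alpha> u B)"
        unfolding tests(1) by (simp add: sum_nonneg tests(2))
      also have "\<dots> = ((\<Sum>b\<in>B. P.h'' u (P.pull u b) (P.pull u b)) + P.h' u (P.drift \<alpha> u B))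
        + \<epsilon> * ((\<Sum>b\<in>B. P.r2'' u (P.pull u b) (P.pull u b)) + P.r2' u (P.drift \<alpha> u B))"
        by (simp add: \<zeta>'_def \<zeta>''_def sum.distrib sum_distrib_left algebra_simps)
      also have "\<dots> \<le> 0 + \<epsilon> * (2 * DIM('a) + 4 * (1 + \<alpha>) * (H q)^2 - \<alpha> * (norm (F q))^2)"
      proof (intro add_mono mult_left_mono)
        show "(\<Sum>b\<in>B. P.h'' u (P.pull u b) (P.pull u b)) + P.h' u (P.drift \<alpha> u B) \<le> 0"
          unfolding B_def by (rule H_supersolution[OF c])
        have "F q \<bullet> N q = - 2 * H q" by (simp add: H_eq)
        moreover have "P.mc u = H q" using P.mc_eq_h[OF c(2)] H_chart[OF c(1)] qu by simp
        ultimately show "(\<Sum>b\<in>B. P.r2'' u (P.pull u b) (P.pull u b)) + P.r2' u (P.drift \<alpha> u B)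
            \<le> 2 * DIM('a) + 4 * (1 + \<alpha>) * (H q)^2 - \<alpha> * (norm (F q))^2"
          unfolding P.r2_operator by (simp add: qu[symmetric] power2_eq_square algebra_simps)
      qed (use \<epsilon> in simp)
      also have "\<dots> < 0" using R[of q] far \<epsilon> by (simp add: mult_pos_neg)
      finally show False by simp
    qed
    then have "H p0 \<le> H q" by (intro p0) (simp add: K_def)
    also have "\<dots> \<le> G q" using \<epsilon> by (simp add: G_def)
    also have "\<dots> \<le> G p" by (rule q)
    finally show ?thesis by (simp add: G_def)
  qed
  have "H p0 \<le> H p" for p
  proof (rule field_le_epsilon)
    fix e :: real assume e: "e > 0"
    have n: "(norm (F p))^2 + 1 > 0" by (simp add: add_nonneg_pos)
    have "H p0 \<le> H p + e / ((norm (F p))^2 + 1) * (norm (F p))^2" using e n by (intro le) simp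
    also have "e / ((norm (F p))^2 + 1) * (norm (F p))^2 \<le> e"
      using e n by (simp add: field_simps)
    finally show "H p0 \<le> H p + e" by simp
  qed
  then show ?thesis by blast
qed

lemma H_constant: "\<exists>m. \<forall>p. H p = m"
proof -
  obtain p0 where p0: "\<And>p. H p0 \<le> H p" using H_attains_min by blast
  have "open {p. H p = H p0}"
  proof (subst open_subopen, intro ballI)
    fix p assume p: "p \<in> {p. H p = H p0}"
    obtain V \<psi> u where c: "(V, \<psi>) \<in> \<A>" "u \<in> V" and pu: "p = \<psi> u" by (rule chart_at)
    interpret P: hypersurface_patch V "F \<circ> \<psi>" "N \<circ> \<psi>" by (rule patch[OF c(1)])
    define B where "B y = orthonormal_frame \<A> F (\<psi> y)" for y
    have "open {y \<in> V. P.h y = H p0}"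
    proof (rule strong_minimum_principle[OF P.V P.h_has_derivative P.h'_has_derivative, where I = B and e = P.pull
          and \<beta> = "\<lambda>y. P.drift \<alpha> y (B y)"])
      show "(\<Sum>i\<in>B y. P.h'' y (P.pull y i) (P.pull y i)) + P.h' y (P.drift \<alpha> y (B y)) \<le> 0" if "y \<in> V" for y
        unfolding B_def by (rule H_supersolution[OF c(1) that])
      show "\<exists>r>0. \<exists>l>0. \<exists>C. \<forall>x\<in>V \<inter> ball x0 r.
        (\<forall>y. l * (norm y)\<^sup>2 \<le> (\<Sum>i\<in>B x. (y \<bullet> P.pull x i)\<^sup>2)) \<and>
        (\<Sum>i\<in>B x. (norm (P.pull x i))\<^sup>2) \<le> C \<and> norm (P.drift \<alpha> x (B x)) \<le> C" if "x0 \<in> V" for x0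
        using that orthonormal_frame_chart[OF c(1)] unfolding B_def by (intro P.elliptic)
      show "H p0 \<le> P.h y" if "y \<in> V" for y using p0[of "\<psi> y"] H_chart[OF c(1), of y] by simp
    qed
    then have "open (\<psi> ` {y \<in> V. P.h y = H p0})" by (rule chart_open_image[OF c(1)]) auto
    moreover have "p \<in> \<psi> ` {y \<in> V. P.h y = H p0}"
      using p c(2) H_chart[OF c(1), of u] by (auto simp: pu)
    moreover have "\<psi> ` {y \<in> V. P.h y = H p0} \<subseteq> {p. H p = H p0}"
      using H_chart[OF c(1)] by auto
    ultimately show "\<exists>T. open T \<and> p \<in> T \<and> T \<subseteq> {p. H p = H p0}" by blast
  qed
  moreover have "closed {p. H p = H p0}"
    by (rule closed_Collect_eq[OF continuous_H]) simp
  ultimately have "{p. H p = H p0} = {} \<or> {p. H p = H p0} = UNIV"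
    using connected unfolding connected_clopen by (simp del: Collect_empty_eq)
  then show ?thesis by (intro exI[of _ "H p0"]) auto
qed

text \<open>For constant \<open>H\<close> the equation for \<open>\<Delta>H\<close> reads \<open>(|A|\<^sup>2 + 1/2) H = 0\<close>.\<close>

lemma H_zero: "H p = 0"
proof -
  obtain m where m: "\<And>p. H p = m" using H_constant by blast
  obtain V \<psi> u where c: "(V, \<psi>) \<in> \<A>" "u \<in> V" and pu: "p = \<psi> u" by (rule chart_at)
  interpret P: expander_frame V "F \<circ> \<psi>" "N \<circ> \<psi>" u "orthonormal_frame \<A> F (\<psi> u)"
    by (rule expander_frame[OF c])
  have h': "P.h' y v = 0" if "y \<in> V" for y v
    by (rule has_derivative_const_on_open[OF P.V that P.h_has_derivative[OF that], of m])
       (use m H_chart[OF c(1)] in simp)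
  have h'': "P.h'' u v w = 0" for v w
    by (rule has_derivative_const_on_open[OF P.V c(2) P.h'_has_derivative[OF c(2)], of v 0])
       (use h' in simp)
  have "(P.norm_sq_A + 1 / 2) * P.h u = 0"
    using P.h_operator[of \<alpha>] by (simp add: h'' h' c(2) algebra_simps)
  moreover have "P.norm_sq_A \<ge> 0" unfolding P.norm_sq_A_def by (simp add: sum_nonneg)
  ultimately have "P.h u = 0" by simp
  then show ?thesis using H_chart[OF c(1), of u] pu by simp
qed

end


section \<open>Proper local homeomorphisms onto Euclidean space\<close>

lemma continuous_on_inv_into_open_map:
  fixes G :: "'m::topological_space \<Rightarrow> 'a::topological_space"
  assumes cont: "continuous_on UNIV G" and om: "\<And>U. open U \<Longrightarrow> open (G ` U)"
    and U: "open U" "inj_on G U"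
  shows "continuous_on (G ` U) (inv_into U G)"
proof (rule continuous_on_inverse_open_map)
  show "continuous_on U G" using continuous_on_subset[OF cont] by blast
  show "G ` U = G ` U" ..
  show "inv_into U G (G x) = x" if "x \<in> U" for x using U(2) that by simp
  fix T assume "openin (top_of_set U) T"
  then have "open T" "T \<subseteq> U" using openin_open_eq[OF U(1)] by simp_all
  then show "openin (top_of_set (G ` U)) (G ` T)"
    using om[of T] om[OF U(1)] by (simp add: openin_open_eq image_mono)
qed

text \<open>The set where two sections agree is open because \<open>G\<close> is locally injective, and closed because the space
  upstairs is Hausdorff.\<close>

lemma section_unique:
  fixes G :: "'m::t2_space \<Rightarrow> 'a::topological_space"
  assumes loc: "\<And>p. \<exists>W. open W \<and> p \<in> W \<and> inj_on G W"
    and E: "connected E"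
    and s1: "continuous_on E s1" "\<And>y. y \<in> E \<Longrightarrow> G (s1 y) = y"
    and s2: "continuous_on E s2" "\<And>y. y \<in> E \<Longrightarrow> G (s2 y) = y"
    and y0: "y0 \<in> E" "s1 y0 = s2 y0" and y: "y \<in> E"
  shows "s1 y = s2 y"
proof -
  define A where "A = {y \<in> E. s1 y = s2 y}"
  have pre: "openin (top_of_set E) (E \<inter> s1 -` W1 \<inter> (E \<inter> s2 -` W2))" if "open W1" "open W2" for W1 W2
    by (intro openin_Int continuous_openin_preimage_gen s1 s2 that)
  have "openin (top_of_set E) A"
  proof (subst openin_subopen, intro ballI)
    fix y assume y: "y \<in> A"
    obtain W where W: "open W" "s1 y \<in> W" "inj_on G W" using loc by blast
    let ?T = "E \<inter> s1 -` W \<inter> (E \<inter> s2 -` W)"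
    have "?T \<subseteq> A"
    proof
      fix x assume x: "x \<in> ?T"
      then have "G (s1 x) = G (s2 x)" using s1(2) s2(2) by simp
      then show "x \<in> A" using x W(3) by (auto simp: A_def inj_on_def)
    qed
    moreover have "y \<in> ?T" using y W by (simp add: A_def)
    ultimately show "\<exists>T. openin (top_of_set E) T \<and> y \<in> T \<and> T \<subseteq> A"
      using pre[OF W(1) W(1)] by blast
  qed
  moreover have "openin (top_of_set E) (E - A)"
  proof (subst openin_subopen, intro ballI)
    fix y assume y: "y \<in> E - A"
    then have ne: "s1 y \<noteq> s2 y" by (simp add: A_def)
    then obtain W1 W2 where W: "open W1" "open W2" "s1 y \<in> W1" "s2 y \<in> W2" "W1 \<inter> W2 = {}"
      using hausdorff[OF ne] by blast
    let ?T = "E \<inter> s1 -` W1 \<inter> (E \<inter> s2 -` W2)"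
    have "?T \<subseteq> E - A"
    proof
      fix x assume x: "x \<in> ?T"
      then have "s1 x \<noteq> s2 x" using W(5) by auto
      then show "x \<in> E - A" using x by (simp add: A_def)
    qed
    moreover have "y \<in> ?T" using y W by simp
    ultimately show "\<exists>T. openin (top_of_set E) T \<and> y \<in> T \<and> T \<subseteq> E - A"
      using pre[OF W(1,2)] by blast
  qed
  moreover have "A \<subseteq> E" by (auto simp: A_def)
  ultimately have "openin (top_of_set E) A" "closedin (top_of_set E) A"
    by (simp_all add: closedin_def)
  then have "A = {} \<or> A = E" using E unfolding connected_clopen by blast
  moreover have "y0 \<in> A" using y0 by (simp add: A_def)
  ultimately have "A = E" by blast
  then have "y \<in> A" using y by simp
  then show ?thesis by (simp add: A_def)
qed

text \<open>Local injectivity says that the pairs of distinct points with equal image form a closed set \<open>- D\<close>; it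
  misses the compact square \<open>K \<times> K\<close>, hence a neighbourhood of it of the form \<open>U \<times> V\<close>.\<close>

lemma inj_on_neighbourhood_of_compact:
  fixes G :: "'m::t2_space \<Rightarrow> 'a::t2_space"
  assumes cont: "continuous_on UNIV G"
    and loc: "\<And>p. \<exists>W. open W \<and> p \<in> W \<and> inj_on G W"
    and K: "compact K" "inj_on G K"
  shows "\<exists>W. open W \<and> K \<subseteq> W \<and> inj_on G W"
proof -
  define D where "D = {(p, q). G p = G q \<longrightarrow> p = q}"
  have "openin (prod_topology euclidean euclidean) D"
    unfolding openin_prod_topology_alt
  proof (intro allI impI)
    fix p q assume pq: "(p, q) \<in> D"
    show "\<exists>U V. openin euclidean U \<and> openin euclidean V \<and> p \<in> U \<and> q \<in> V \<and> U \<times> V \<subseteq> D"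
    proof (cases "p = q")
      case True
      obtain W where "open W" "p \<in> W" "inj_on G W" using loc by blast
      then show ?thesis using True
        by (intro exI[of _ W]) (auto simp: D_def inj_on_def simp flip: open_openin)
    next
      case False
      then have ne: "G p \<noteq> G q" using pq by (simp add: D_def)
      then obtain W1 W2 where W: "open W1" "open W2" "G p \<in> W1" "G q \<in> W2" "W1 \<inter> W2 = {}"
        using hausdorff[OF ne] by blast
      have "open (G -` W1)" "open (G -` W2)"
        using open_vimage[OF W(1) cont] open_vimage[OF W(2) cont] .
      then show ?thesis using W
        by (intro exI[of _ "G -` W1"] exI[of _ "G -` W2"]) (auto simp: D_def simp flip: open_openin)
    qed
  qed
  moreover have "K \<times> K \<subseteq> D" using K(2) by (auto simp: D_def inj_on_def)
  ultimately obtain U V where "open U" "open V" "K \<subseteq> U" "K \<subseteq> V" "U \<times> V \<subseteq> D"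
    using Wallace_theorem_prod_topology[of euclidean K euclidean K D] K(1)
    by (auto simp flip: open_openin)
  then show ?thesis
    by (intro exI[of _ "U \<inter> V"]) (auto simp: D_def inj_on_def)
qed

text \<open>The covering map argument without path lifting. A sheet is an open set containing a fixed point and mapped
  bijectively onto a ball around its image. Sheets are nested by uniqueness of sections. If their radii were
  bounded, the union \<open>S\<close> of all sheets would be a largest one; properness makes its closure compact, uniqueness of
  sections over the convex set \<open>ball \<inter> ball\<close> makes \<open>G\<close> injective on the closure, and injectivity on a
  neighbourhood of the closure yields a larger sheet. So \<open>S\<close> is mapped bijectively onto the whole space, and
  it is closed by continuity of the section; connectedness gives that it is everything.\<close>

theorem proper_local_homeomorphism_bij:
  fixes G :: "'m::t2_space \<Rightarrow> 'a::euclidean_space"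
  assumes conn: "connected (UNIV :: 'm set)" and cont: "continuous_on UNIV G"
    and om: "\<And>U. open U \<Longrightarrow> open (G ` U)"
    and loc: "\<And>p. \<exists>W. open W \<and> p \<in> W \<and> inj_on G W"
    and proper: "\<And>K. compact K \<Longrightarrow> compact (G -` K)"
  shows "bij G"
proof -
  fix p0 :: 'm
  define y0 where "y0 = G p0"
  define sheet where "sheet r U \<longleftrightarrow> r > 0 \<and> open U \<and> p0 \<in> U \<and> inj_on G U \<and> G ` U = ball y0 r" for r U
  have vim: "open (G -` T)" if "open T" for T using open_vimage[OF that cont] .
  have inv_cont: "continuous_on (G ` U) (inv_into U G)" if "open U" "inj_on G U" for U
    by (rule continuous_on_inv_into_open_map[OF cont om that])
  have ex: "\<exists>r U. sheet r U"
  proof -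
    obtain W where W: "open W" "p0 \<in> W" "inj_on G W" using loc by blast
    have "y0 \<in> G ` W" using W(2) by (simp add: y0_def)
    then obtain r where r: "r > 0" "ball y0 r \<subseteq> G ` W" using om[OF W(1)] openE by blast
    have "sheet r (W \<inter> G -` ball y0 r)"
      unfolding sheet_def using r W vim[of "ball y0 r"]
      by (auto simp: y0_def inj_on_def)
    then show ?thesis by blast
  qed
  have nested: "U \<subseteq> U'" if "sheet r U" "sheet r' U'" "r \<le> r'" for r r' U U'
  proof
    fix u assume u: "u \<in> U"
    have U: "open U" "p0 \<in> U" "inj_on G U" "G ` U = ball y0 r" "r > 0"
      and U': "open U'" "p0 \<in> U'" "inj_on G U'" "G ` U' = ball y0 r'"
      using that by (auto simp: sheet_def)
    have sub: "ball y0 r \<subseteq> ball y0 r'" using that(3) by auto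
    have "inv_into U G (G u) = inv_into U' G (G u)"
    proof (rule section_unique[OF loc, of "ball y0 r"])
      show "continuous_on (ball y0 r) (inv_into U G)" using inv_cont[OF U(1,3)] U(4) by simp
      show "continuous_on (ball y0 r) (inv_into U' G)"
        using inv_cont[OF U'(1,3)] U'(4) sub continuous_on_subset by metis
      show "G (inv_into U G y) = y" if "y \<in> ball y0 r" for y using that U(4) f_inv_into_f by metis
      show "G (inv_into U' G y) = y" if "y \<in> ball y0 r" for y using that U'(4) sub f_inv_into_f by (metis subsetD)
      show "inv_into U G y0 = inv_into U' G y0" using U U' by (simp add: y0_def)
      show "y0 \<in> ball y0 r" "G u \<in> ball y0 r" using U u by auto
    qed auto
    then have "u = inv_into U' G (G u)" using u U(3) by simp
    moreover have "G u \<in> G ` U'" using u U(4) U'(4) sub by blast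
    ultimately show "u \<in> U'" using inv_into_into by metis
  qed
  define S where "S = \<Union>{U. \<exists>r. sheet r U}"
  have S: "open S" "p0 \<in> S"
    using ex by (auto simp: S_def sheet_def)
  have Sinj: "inj_on G S"
  proof (rule inj_onI)
    fix x y assume "x \<in> S" "y \<in> S" and eq: "G x = G y"
    then obtain r U r' U' where *: "sheet r U" "x \<in> U" "sheet r' U'" "y \<in> U'" by (auto simp: S_def)
    then have "U \<subseteq> U' \<or> U' \<subseteq> U" using nested le_cases by metis
    then obtain U'' where "inj_on G U''" "x \<in> U''" "y \<in> U''" using * unfolding sheet_def by blast
    then show "x = y" using eq by (simp add: inj_on_def)
  qed
  have GS: "y \<in> G ` S" if "sheet r U" "dist y0 y < r" for r U y
  proof -
    have "y \<in> G ` U" using that by (simp add: sheet_def)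
    then show ?thesis using that(1) by (auto simp: S_def)
  qed
  have unbounded: "\<exists>r U. sheet r U \<and> r > r0" for r0
  proof (rule ccontr)
    assume neg: "\<not> ?thesis"
    define radii where "radii = {r. \<exists>U. sheet r U}"
    have bdd: "bdd_above radii" using neg by (auto simp: radii_def bdd_above_def not_less)
    have ne: "radii \<noteq> {}" using ex by (auto simp: radii_def)
    define R where "R = Sup radii"
    have le_R: "r \<le> R" if "sheet r U" for r U
      unfolding R_def using that bdd by (intro cSup_upper) (auto simp: radii_def)
    have R0: "R > 0" using ex le_R by (force simp: sheet_def)
    have GSR: "G ` S = ball y0 R"
    proof (intro equalityI subsetI)
      fix y assume "y \<in> G ` S"
      then obtain r U where "sheet r U" "y \<in> G ` U" by (auto simp: S_def)
      then show "y \<in> ball y0 R" using le_R[of r U] by (auto simp: sheet_def)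
    next
      fix y assume "y \<in> ball y0 R"
      then have "dist y0 y < Sup radii" by (simp add: R_def)
      then obtain r where "r \<in> radii" "dist y0 y < r" using less_cSup_iff[OF ne bdd] by blast
      then show "y \<in> G ` S" using GS by (auto simp: radii_def)
    qed
    have sS: "continuous_on (ball y0 R) (inv_into S G)" using inv_cont[OF S(1) Sinj] GSR by simp
    define K where "K = closure S"
    have "S \<subseteq> G -` cball y0 R"
    proof
      fix x assume "x \<in> S"
      then have "G x \<in> ball y0 R" using GSR by blast
      then show "x \<in> G -` cball y0 R" by simp
    qed
    moreover have cc: "compact (G -` cball y0 R)" by (rule proper) simp
    ultimately have "K \<subseteq> G -` cball y0 R"
      unfolding K_def by (intro closure_minimal compact_imp_closed)
    then have K: "compact K"
      using compact_Int_closed[OF cc closed_closure[of S]] by (simp add: K_def Int_absorb1)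
    have Kinj: "inj_on G K"
    proof (rule inj_onI, rule ccontr)
      fix p q assume p: "p \<in> K" and q: "q \<in> K" and pq: "G p = G q" "p \<noteq> q"
      obtain A' B' where AB': "open A'" "open B'" "p \<in> A'" "q \<in> B'" "A' \<inter> B' = {}"
        using hausdorff[OF pq(2)] by blast
      obtain Wp Wq where W: "open Wp" "p \<in> Wp" "inj_on G Wp" "open Wq" "q \<in> Wq" "inj_on G Wq"
        using loc by metis
      define A B where "A = A' \<inter> Wp" and "B = B' \<inter> Wq"
      have A: "open A" "p \<in> A" "inj_on G A" and B: "open B" "q \<in> B" "inj_on G B" and AB: "A \<inter> B = {}"
        using AB' W by (auto simp: A_def B_def inj_on_def)
      have "G p \<in> G ` A" using A(2) by blast
      moreover have "G p \<in> G ` B" unfolding pq(1) using B(2) by blast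
      ultimately have "G p \<in> G ` A \<inter> G ` B" by blast
      moreover have "open (G ` A \<inter> G ` B)" using om A(1) B(1) by blast
      ultimately obtain \<epsilon> where \<epsilon>: "\<epsilon> > 0" "ball (G p) \<epsilon> \<subseteq> G ` A \<inter> G ` B" using openE by blast
      define E where "E = ball (G p) \<epsilon> \<inter> ball y0 R"
      have E: "connected E" unfolding E_def by (intro convex_connected convex_Int convex_ball)
      \<comment> \<open>The local inverses of \<open>G\<close> near \<open>p\<close> and near \<open>q\<close> both agree with the section over \<open>S\<close>.\<close>
      have agree: "inv_into C G y = inv_into S G y"
        if C: "open C" "inj_on G C" and x: "x \<in> C" "x \<in> K" "G x = G p" and sub: "ball (G p) \<epsilon> \<subseteq> G ` C"
          and y: "y \<in> E" for C x y
      proof -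
        have "open (C \<inter> G -` ball (G p) \<epsilon>)" using C(1) vim by blast
        moreover have "x \<in> C \<inter> G -` ball (G p) \<epsilon>" using x \<epsilon> by simp
        ultimately have "S \<inter> (C \<inter> G -` ball (G p) \<epsilon>) \<noteq> {}"
          using x(2) open_Int_closure_eq_empty[of "C \<inter> G -` ball (G p) \<epsilon>" S] unfolding K_def by blast
        then obtain u where u: "u \<in> S" "u \<in> C" "G u \<in> ball (G p) \<epsilon>" by blast
        show ?thesis
        proof (rule section_unique[OF loc E])
          show "continuous_on E (inv_into C G)"
            using inv_cont[OF C] sub unfolding E_def by (elim continuous_on_subset) blast
          show "continuous_on E (inv_into S G)"
            using sS unfolding E_def by (elim continuous_on_subset) blast
          show "G (inv_into C G y) = y" if "y \<in> E" for y
            using that sub unfolding E_def by (intro f_inv_into_f) blast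
          show "G (inv_into S G y) = y" if "y \<in> E" for y
            using that GSR unfolding E_def by (intro f_inv_into_f) blast
          have "G u \<in> ball y0 R" using u(1) GSR by blast
          then show "G u \<in> E" using u(3) by (simp add: E_def)
          show "inv_into C G (G u) = inv_into S G (G u)" using u C(2) Sinj by simp
        qed (rule y)
      qed
      have "p \<in> closure S" using p by (simp add: K_def)
      moreover have "open (G -` ball (G p) \<epsilon>)" "p \<in> G -` ball (G p) \<epsilon>" using vim \<epsilon> by auto
      ultimately obtain u where "u \<in> S" "G u \<in> ball (G p) \<epsilon>"
        using open_Int_closure_eq_empty[of "G -` ball (G p) \<epsilon>" S] by blast
      then have y: "G u \<in> E" using GSR unfolding E_def by blast
      have "inv_into A G (G u) = inv_into B G (G u)"
        using agree[OF A(1,3,2) p _ _ y] agree[OF B(1,3,2) q _ _ y] \<epsilon>(2) pq(1) by simp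
      moreover have "G u \<in> G ` A" "G u \<in> G ` B" using y \<epsilon>(2) unfolding E_def by blast+
      ultimately show False using AB inv_into_into[of "G u" G A] inv_into_into[of "G u" G B] by auto
    qed
    obtain W where W: "open W" "K \<subseteq> W" "inj_on G W"
      using inj_on_neighbourhood_of_compact[OF cont loc K Kinj] by blast
    have SK: "S \<subseteq> K" unfolding K_def by (rule closure_subset)
    have "closed (G ` K)"
      using compact_continuous_image[OF continuous_on_subset[OF cont] K] compact_imp_closed by blast
    moreover have "ball y0 R \<subseteq> G ` K" using GSR SK by blast
    ultimately have "closure (ball y0 R) \<subseteq> G ` K" by (rule closure_minimal[rotated])
    then have "cball y0 R \<subseteq> G ` W" using R0 W(2) by auto
    then obtain \<delta> where \<delta>: "\<delta> > 0" "ball y0 (R + \<delta>) \<subseteq> G ` W"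
    proof -
      assume that: "\<And>\<delta>. \<delta> > 0 \<Longrightarrow> ball y0 (R + \<delta>) \<subseteq> G ` W \<Longrightarrow> thesis" and sub: "cball y0 R \<subseteq> G ` W"
      define C where "C = cball y0 (R + 1) - G ` W"
      show thesis
      proof (cases "C = {}")
        case True
        then have "ball y0 (R + 1) \<subseteq> G ` W"
          using ball_subset_cball[of y0 "R + 1"] unfolding C_def by blast
        then show thesis using that[of 1] by simp
      next
        case False
        have "closed C" unfolding C_def using om[OF W(1)] by (intro closed_Diff closed_cball)
        then obtain y1 where y1: "y1 \<in> C" "\<And>y. y \<in> C \<Longrightarrow> dist y0 y1 \<le> dist y0 y"
          using distance_attains_inf[OF _ False, of y0] by blast
        have far: "dist y0 y1 > R" using y1(1) sub by (auto simp: C_def not_le[symmetric])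
        have "dist y0 y1 \<le> R + 1" using y1(1) by (simp add: C_def)
        then have "y \<in> G ` W" if "dist y0 y < dist y0 y1" for y
          using that y1(2)[of y] \<open>dist y0 y1 \<le> R + 1\<close> by (force simp: C_def)
        then have "ball y0 (dist y0 y1) \<subseteq> G ` W" by (simp add: subset_iff)
        then show thesis using far that[of "dist y0 y1 - R"] by simp
      qed
    qed
    have "p0 \<in> W" using S(2) SK W(2) by blast
    have "sheet (R + \<delta>) (W \<inter> G -` ball y0 (R + \<delta>))"
      unfolding sheet_def
    proof (intro conjI)
      show "0 < R + \<delta>" using R0 \<delta> by simp
      show "open (W \<inter> G -` ball y0 (R + \<delta>))" using W(1) vim by blast
      show "p0 \<in> W \<inter> G -` ball y0 (R + \<delta>)" using \<open>p0 \<in> W\<close> R0 \<delta> by (simp add: y0_def)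
      show "inj_on G (W \<inter> G -` ball y0 (R + \<delta>))" using W(3) by (rule inj_on_subset) blast
      show "G ` (W \<inter> G -` ball y0 (R + \<delta>)) = ball y0 (R + \<delta>)" using \<delta>(2) by blast
    qed
    then have "R + \<delta> \<le> R" by (rule le_R)
    then show False using \<delta> by simp
  qed
  have GS_UNIV: "G ` S = UNIV"
  proof -
    have "y \<in> G ` S" for y
      using unbounded[of "dist y0 y"] GS by blast
    then show ?thesis by blast
  qed
  have sec: "continuous_on UNIV (inv_into S G)" using inv_cont[OF S(1) Sinj] GS_UNIV by simp
  have "closed S"
  proof (rule closure_subset_eq[THEN iffD1], rule subsetI, rule ccontr)
    fix p assume p: "p \<in> closure S" "p \<notin> S"
    have qS: "inv_into S G y \<in> S" for y using GS_UNIV inv_into_into[of y G S] by blast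
    have ne: "p \<noteq> inv_into S G (G p)" using p(2) qS[of "G p"] by auto
    then obtain A B where AB: "open A" "open B" "p \<in> A" "inv_into S G (G p) \<in> B" "A \<inter> B = {}"
      using hausdorff[OF ne] by blast
    have "open (A \<inter> G -` (inv_into S G -` B))"
      using AB vim open_vimage[OF AB(2) sec] by blast
    moreover have "p \<in> A \<inter> G -` (inv_into S G -` B)" using AB by simp
    ultimately obtain u where "u \<in> S" "u \<in> A" "inv_into S G (G u) \<in> B"
      using p(1) open_Int_closure_eq_empty[of "A \<inter> G -` (inv_into S G -` B)" S] by blast
    moreover from this have "inv_into S G (G u) = u" using Sinj by simp
    ultimately show False using AB(5) by auto
  qed
  then have "S = {} \<or> S = UNIV" using S(1) conn unfolding connected_clopen by simp
  then have "S = UNIV" using S(2) by blast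
  then show ?thesis using Sinj GS_UNIV by (simp add: bij_def)
qed


section \<open>Hypersurfaces with tangential position vector\<close>

context hypersurface
begin

text \<open>In a chart \<open>pull u\<close> is a left inverse of the derivative, and the derivative is continuous, so the
  injectivity part of the inverse function theorem applies.\<close>

lemma immersion_locally_injective: "\<exists>W. open W \<and> p \<in> W \<and> inj_on F W"
proof -
  obtain V \<psi> u where c: "(V, \<psi>) \<in> \<A>" "u \<in> V" and pu: "p = \<psi> u" by (rule chart_at)
  interpret P: hypersurface_patch V "F \<circ> \<psi>" "N \<circ> \<psi>" by (rule patch[OF c(1)])
  obtain r where r: "r > 0" "ball u r \<subseteq> V" "inj_on (F \<circ> \<psi>) (ball u r)"
  proof (rule has_derivative_locally_injective[where f = "F \<circ> \<psi>" and f' = "\<lambda>x v. dird (F \<circ> \<psi>) v x"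
        and S = V and g' = "P.pull u" and a = u])
    show "bounded_linear (P.pull u)" using P.linear_pull[OF c(2)] by (simp add: linear_conv_bounded_linear)
    show "P.pull u \<circ> (\<lambda>v. dird (F \<circ> \<psi>) v u) = id" by (rule ext) (simp only: o_apply P.pull_df[OF c(2)] id_apply)
    show "((F \<circ> \<psi>) has_derivative (\<lambda>v. dird (F \<circ> \<psi>) v x)) (at x)" if "x \<in> V" for x
      by (rule smooth_on_has_derivative[OF P.f that])
    fix e :: real assume e: "e > 0"
    define \<tau> where "\<tau> x = (\<Sum>i\<in>Basis. norm (dird (F \<circ> \<psi>) i x - dird (F \<circ> \<psi>) i u))" for x
    have "isCont \<tau> u" unfolding \<tau>_def[abs_def]
      by (intro continuous_intros smooth_on_isCont[OF smooth_on_dird[OF P.f] c(2)])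
    then have "(\<tau> \<longlongrightarrow> \<tau> u) (nhds u)"
      using tendsto_at_iff_tendsto_nhds[of \<tau> u] by (simp add: isCont_def)
    moreover have "\<tau> u < e" using e by (simp add: \<tau>_def)
    ultimately have "\<forall>\<^sub>F x in nhds u. \<tau> x < e" by (rule order_tendstoD(2))
    with eventually_nhds_in_open[OF P.V c(2)] have "\<forall>\<^sub>F x in nhds u. x \<in> V \<and> \<tau> x < e"
      by (rule eventually_conj)
    then obtain d where d: "d > 0" "\<And>x. dist x u < d \<Longrightarrow> x \<in> V \<and> \<tau> x < e"
      unfolding eventually_nhds_metric by blast
    have "onorm (\<lambda>v. dird (F \<circ> \<psi>) v x - dird (F \<circ> \<psi>) v u) < e" if "dist u x < d" for x
    proof -
      have x: "x \<in> V" "\<tau> x < e" using d(2)[of x] that by (auto simp: dist_commute)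
      have "onorm (\<lambda>v. dird (F \<circ> \<psi>) v x - dird (F \<circ> \<psi>) v u) \<le> \<tau> x"
        unfolding \<tau>_def
        by (intro onorm_bound norm_linear_le_sum_Basis linear_compose_sub P.linear_df x c(2) sum_nonneg norm_ge_zero)
      then show ?thesis using x(2) by simp
    qed
    then show "\<exists>d>0. \<forall>x. dist u x < d \<longrightarrow> onorm (\<lambda>v. dird (F \<circ> \<psi>) v x - dird (F \<circ> \<psi>) v u) < e"
      using d(1) by blast
  qed (use P.V c(2) in auto)
  have "open (\<psi> ` ball u r)" by (rule chart_open_image[OF c(1) open_ball r(2)])
  moreover have "inj_on F (\<psi> ` ball u r)" using r(3) by (rule inj_on_imageI)
  moreover have "p \<in> \<psi> ` ball u r" using r(1) pu by simp
  ultimately show ?thesis by blast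
qed

end

text \<open>The position vector is everywhere tangential: locally such a hypersurface is a cone.\<close>

locale conical_hypersurface = hypersurface \<A> F N
  for \<A> :: "('a::euclidean_space, 'm::{t2_space, second_countable_topology}) atlas"
    and F N :: "'m \<Rightarrow> 'b::euclidean_space" +
  assumes connected: "connected (UNIV :: 'm set)"
    and proper: "proper_map_into F"
    and tangential: "\<And>p. F p \<bullet> N p = 0"
begin

text \<open>The preimage of the origin is compact by properness and discrete by local injectivity.\<close>

lemma finite_zeros: "finite (F -` {0})"
proof -
  have compact: "compact (F -` {0})" using proper unfolding proper_map_into_def by simp
  have "\<forall>z\<in>F -` {0}. \<exists>W. open W \<and> z \<in> W \<and> W \<inter> F -` {0} \<subseteq> {z}"
  proof
    fix z assume z: "z \<in> F -` {0}"
    obtain W where W: "open W" "z \<in> W" "inj_on F W" using immersion_locally_injective by blast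
    have "W \<inter> F -` {0} \<subseteq> {z}"
    proof
      fix y assume "y \<in> W \<inter> F -` {0}"
      then show "y \<in> {z}" using z W by (auto simp: inj_on_def)
    qed
    then show "\<exists>W. open W \<and> z \<in> W \<and> W \<inter> F -` {0} \<subseteq> {z}" using W(1,2) by blast
  qed
  from bchoice[OF this] obtain W
    where W: "\<And>z. z \<in> F -` {0} \<Longrightarrow> open (W z) \<and> z \<in> W z \<and> W z \<inter> F -` {0} \<subseteq> {z}"
    by auto
  have "F -` {0} \<subseteq> (\<Union>z\<in>F -` {0}. W z)"
  proof
    fix z assume "z \<in> F -` {0}"
    then show "z \<in> (\<Union>z\<in>F -` {0}. W z)" using W[of z] by (intro UN_I[of z]) auto
  qed
  with compact obtain D where D: "D \<subseteq> F -` {0}" "finite D" "F -` {0} \<subseteq> (\<Union>z\<in>D. W z)"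
    using compactE_image[of "F -` {0}" "F -` {0}" W] W by (metis (no_types))
  have "F -` {0} \<subseteq> D"
  proof
    fix y assume y: "y \<in> F -` {0}"
    then obtain z where z: "z \<in> D" "y \<in> W z" using D(3) by blast
    then have "y = z" using W[of z] D(1) y by blast
    then show "y \<in> D" using z by simp
  qed
  then show ?thesis using D(2) finite_subset by blast
qed

lemma position_tangent:
  assumes c: "(V, \<psi>) \<in> \<A>" "u \<in> V"
  shows "dird (F \<circ> \<psi>) (hypersurface_patch.pull (F \<circ> \<psi>) (N \<circ> \<psi>) u (F (\<psi> u))) u = F (\<psi> u)"
proof -
  interpret P: hypersurface_patch V "F \<circ> \<psi>" "N \<circ> \<psi>" by (rule patch[OF c(1)])
  show ?thesis by (simp add: P.df_pull[OF c(2)] tangential)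
qed

text \<open>Differentiating \<open>\<langle>F, N\<rangle> = 0\<close> gives \<open>\<langle>F, DN(v)\<rangle> = 0\<close>, which by symmetry of the second fundamental form is
  \<open>\<langle>DN(w), DF(v)\<rangle> = 0\<close> for the direction \<open>w\<close> with \<open>DF(w) = F\<close>.\<close>

lemma normal_radially_constant:
  assumes c: "(V, \<psi>) \<in> \<A>" "u \<in> V"
  shows "dird (N \<circ> \<psi>) (hypersurface_patch.pull (F \<circ> \<psi>) (N \<circ> \<psi>) u (F (\<psi> u))) u = 0"
proof -
  interpret P: hypersurface_patch V "F \<circ> \<psi>" "N \<circ> \<psi>" by (rule patch[OF c(1)])
  let ?w = "P.pull u (F (\<psi> u))"
  have h': "P.h' u v = 0" for v
    by (rule has_derivative_const_on_open[OF P.V c(2) P.h_has_derivative[OF c(2)], of 0])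
       (simp add: P.h_def tangential)
  have "dird (N \<circ> \<psi>) ?w u \<bullet> dird (F \<circ> \<psi>) v u = 0" for v
    using P.d\<nu>_symmetric[OF c(2), of ?w v] position_tangent[OF c] h'[of v]
    by (simp add: P.h'_def inner_commute)
  from this[of "P.pull u (dird (N \<circ> \<psi>) ?w u)"] show ?thesis
    by (simp add: P.df_pull_d\<nu>[OF c(2)])
qed

text \<open>At an extremum of a radially constant function perturbed by the squared distance to the origin
  the radial derivative of the perturbation vanishes as well, so the extremum lies over the origin.\<close>

lemma radially_constant_le:
  fixes g :: "'m \<Rightarrow> real"
  assumes cont: "continuous_on UNIV g" and bound: "\<And>p. g p \<le> C"
    and radial: "\<And>V \<psi> u. (V, \<psi>) \<in> \<A> \<Longrightarrow> u \<in> V \<Longrightarrow> \<exists>g'. ((g \<circ> \<psi>) has_derivative g') (at u) \<and>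
        g' (hypersurface_patch.pull (F \<circ> \<psi>) (N \<circ> \<psi>) u (F (\<psi> u))) = 0"
    and zeros: "\<And>z. F z = 0 \<Longrightarrow> g z \<le> m"
  shows "g p \<le> m"
proof (rule field_le_epsilon)
  fix e :: real assume e: "e > 0"
  have n: "(norm (F p))^2 + 1 > 0" by (simp add: add_nonneg_pos)
  define \<epsilon> where "\<epsilon> = e / ((norm (F p))^2 + 1)"
  have \<epsilon>: "\<epsilon> > 0" using e n by (simp add: \<epsilon>_def)
  define G where "G p = \<epsilon> * (norm (F p))^2 - g p" for p
  have "\<exists>q. \<forall>p. G q \<le> G p"
  proof (rule coercive_attains_min[OF proper _ \<epsilon>])
    show "continuous_on UNIV G" unfolding G_def[abs_def]
      by (intro continuous_intros cont smooth_map_continuous[OF smooth_maps(1)])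
    show "- C + \<epsilon> * (norm (F p))^2 \<le> G p" for p using bound[of p] by (simp add: G_def)
  qed
  then obtain q where q: "\<And>p. G q \<le> G p" by blast
  have "F q = 0"
  proof -
    obtain V \<psi> u where c: "(V, \<psi>) \<in> \<A>" "u \<in> V" and qu: "q = \<psi> u" by (rule chart_at)
    interpret P: hypersurface_patch V "F \<circ> \<psi>" "N \<circ> \<psi>" by (rule patch[OF c(1)])
    let ?w = "P.pull u (F (\<psi> u))"
    obtain g' where g': "((g \<circ> \<psi>) has_derivative g') (at u)" "g' ?w = 0" using radial[OF c] by blast
    have d: "((\<lambda>y. \<epsilon> * ((F \<circ> \<psi>) y \<bullet> (F \<circ> \<psi>) y) - (g \<circ> \<psi>) y) has_derivative (\<lambda>v. \<epsilon> * P.r2' u v - g' v)) (at u)"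
      by (intro has_derivative_diff has_derivative_mult_right P.r2_has_derivative c g')
    have "(\<lambda>v. \<epsilon> * P.r2' u v - g' v) = (\<lambda>v. 0)"
      using q qu by (intro differential_zero_maxmin[OF c(2) P.V d]) (simp add: G_def power2_norm_eq_inner)
    from fun_cong[OF this, of ?w] have "P.r2' u ?w = 0" using g'(2) \<epsilon> by simp
    then show ?thesis using position_tangent[OF c] by (simp add: P.r2'_def qu)
  qed
  then have "g q \<le> m" "G q = - g q" using zeros by (simp_all add: G_def)
  moreover have "G q \<le> \<epsilon> * (norm (F p))^2 - g p" using q[of p] by (simp only: G_def)
  ultimately have "g p \<le> m + \<epsilon> * (norm (F p))^2" by linarith
  also have "\<epsilon> * (norm (F p))^2 \<le> e" using e n by (simp add: \<epsilon>_def field_simps)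
  finally show "g p \<le> m + e" by simp
qed

text \<open>The product \<open>g\<close> vanishes exactly where \<open>N\<close> takes one of its values over the origin. It is constant along
  the position field, so it is bounded by its value zero over the origin.\<close>

lemma normal_constant: "\<exists>v. \<forall>p. N p = v"
proof -
  define Z where "Z = F -` {0}"
  have Z: "finite Z" unfolding Z_def using finite_zeros .
  define g where "g p = (\<Prod>z\<in>Z. (norm (N p - N z))^2)" for p
  have N: "continuous_on UNIV N" by (rule smooth_map_continuous[OF smooth_maps(2)])
  have N1: "norm (N p) = 1" for p using N_unit by (simp add: norm_eq_1)
  have "g p \<le> 0" for p
  proof (rule radially_constant_le)
    show "continuous_on UNIV g" unfolding g_def[abs_def] by (intro continuous_intros N)
    show "g p \<le> (\<Prod>z\<in>Z. 2^2)" for p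
      unfolding g_def
    proof (intro prod_mono conjI power_mono)
      show "norm (N p - N z) \<le> 2" for z using norm_triangle_ineq4[of "N p" "N z"] N1 by simp
    qed auto
    show "g z \<le> 0" if "F z = 0" for z
    proof -
      have "z \<in> Z" using that by (simp add: Z_def)
      then have "g z = 0" unfolding g_def using Z by (intro prod_zero) auto
      then show ?thesis by simp
    qed
    fix V \<psi> u assume c: "(V, \<psi>) \<in> \<A>" "u \<in> V"
    interpret P: hypersurface_patch V "F \<circ> \<psi>" "N \<circ> \<psi>" by (rule patch[OF c(1)])
    let ?w = "P.pull u (F (\<psi> u))"
    define k' where "k' z v = 2 * ((N (\<psi> u) - N z) \<bullet> dird (N \<circ> \<psi>) v u)" for z v
    have "((\<lambda>y. (norm ((N \<circ> \<psi>) y - N z))^2) has_derivative k' z) (at u)" for z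
    proof -
      have d: "((\<lambda>y. (N \<circ> \<psi>) y - N z) has_derivative (\<lambda>v. dird (N \<circ> \<psi>) v u - 0)) (at u)"
        by (intro has_derivative_diff smooth_on_has_derivative[OF P.\<nu> c(2)] has_derivative_const)
      show ?thesis
        using has_derivative_inner[OF d d] unfolding k'_def[abs_def] power2_norm_eq_inner
        by (simp add: inner_commute)
    qed
    from has_derivative_prod[OF this]
    have "((g \<circ> \<psi>) has_derivative (\<lambda>v. \<Sum>z\<in>Z. k' z v * (\<Prod>j\<in>Z - {z}. (norm ((N \<circ> \<psi>) u - N j))^2))) (at u)"
      by (simp add: g_def[abs_def] comp_def)
    moreover have "k' z ?w = 0" for z using normal_radially_constant[OF c] by (simp add: k'_def)
    ultimately show "\<exists>g'. ((g \<circ> \<psi>) has_derivative g') (at u) \<and> g' ?w = 0"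
      by (intro exI conjI) (assumption, simp)
  qed
  moreover have "g p \<ge> 0" for p unfolding g_def by (intro prod_nonneg) simp
  ultimately have "g p = 0" for p by (simp add: order_antisym)
  then have "\<exists>z\<in>Z. N p = N z" for p
    using Z unfolding g_def by (simp add: prod_zero_iff)
  then have "range N \<subseteq> N ` Z" by blast
  then have "finite (range N)" using Z finite_subset by blast
  moreover have "connected (range N)" by (rule connected_continuous_image[OF N connected])
  ultimately obtain v where "range N = {v}" using connected_finite_iff_sing[of "range N"] by auto
  then show ?thesis by blast
qed

text \<open>With constant normal \<open>v\<close> the image lies in the hyperplane orthogonal to \<open>v\<close>, which the derivative \<open>T\<close> of one chart at one
  point identifies with the parameter space. In these coordinates the immersion is a proper local
  homeomorphism; openness is invariance of domain.\<close>

lemma hyperplane: "\<exists>v. v \<noteq> 0 \<and> bij_betw F UNIV {x. v \<bullet> x = 0}"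
proof -
  obtain v where v: "\<And>p. N p = v" using normal_constant by blast
  have F: "continuous_on UNIV F" by (rule smooth_map_continuous[OF smooth_maps(1)])
  have vv: "v \<bullet> v = 1" using N_unit by (simp add: v)
  have Fv: "F p \<bullet> v = 0" for p using tangential[of p] by (simp add: v)
  fix p0 :: 'm
  obtain V0 \<psi>0 u0 where c0: "(V0, \<psi>0) \<in> \<A>" "u0 \<in> V0" and "p0 = \<psi>0 u0" by (rule chart_at)
  interpret P0: hypersurface_patch V0 "F \<circ> \<psi>0" "N \<circ> \<psi>0" by (rule patch[OF c0(1)])
  define T where "T w = dird (F \<circ> \<psi>0) w u0" for w
  define J where "J = P0.pull u0"
  have JT: "J (T w) = w" for w unfolding J_def T_def by (rule P0.pull_df[OF c0(2)])
  have TJ: "T (J z) = z" if "z \<bullet> v = 0" for z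
    unfolding J_def T_def using that by (simp add: P0.df_pull[OF c0(2)] v)
  have linT: "linear T" unfolding T_def by (rule P0.linear_df[OF c0(2)])
  have linJ: "linear J" unfolding J_def by (rule P0.linear_pull[OF c0(2)])
  define G where "G p = J (F p)" for p
  have TG: "T (G p) = F p" for p using TJ[OF Fv] by (simp add: G_def)
  have G: "continuous_on UNIV G"
    unfolding G_def[abs_def] using linJ
    by (intro bounded_linear.continuous_on[OF _ F]) (simp add: linear_conv_bounded_linear)
  have loc: "\<exists>W. open W \<and> p \<in> W \<and> inj_on G W" for p
  proof -
    obtain W where W: "open W" "p \<in> W" "inj_on F W" using immersion_locally_injective by blast
    have "inj_on G W" using W(3) TG unfolding inj_on_def by metis
    then show ?thesis using W by blast
  qed
  have "bij G"
  proof (rule proper_local_homeomorphism_bij[OF connected G _ loc])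
    fix U :: "'m set" assume U: "open U"
    show "open (G ` U)"
    proof (subst open_subopen, intro ballI)
      fix y assume "y \<in> G ` U"
      then obtain p where p: "p \<in> U" "y = G p" by blast
      obtain W where W: "open W" "p \<in> W" "inj_on G W" using loc by blast
      obtain V \<psi> u where c: "(V, \<psi>) \<in> \<A>" "u \<in> V" and pu: "p = \<psi> u" by (rule chart_at)
      define O' where "O' = V \<inter> \<psi> -` (U \<inter> W)"
      have "open O'" unfolding O'_def
        using continuous_open_preimage[OF chart_continuous(1)[OF c(1)] chart_props(1)[OF c(1)]] U W(1) by blast
      moreover have "continuous_on O' (G \<circ> \<psi>)"
        using continuous_on_subset[OF chart_continuous(1)[OF c(1)]] continuous_on_subset[OF G]
        by (intro continuous_on_compose) (auto simp: O'_def)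
      moreover have "inj_on (G \<circ> \<psi>) O'"
        using chart_continuous(2)[OF c(1)] W(3) by (auto simp: O'_def inj_on_def)
      ultimately have "open ((G \<circ> \<psi>) ` O')" by (intro invariance_of_domain)
      moreover have "y \<in> (G \<circ> \<psi>) ` O'" using p W(2) c(2) pu by (auto simp: O'_def)
      moreover have "(G \<circ> \<psi>) ` O' \<subseteq> G ` U" by (auto simp: O'_def)
      ultimately show "\<exists>T. open T \<and> y \<in> T \<and> T \<subseteq> G ` U" by blast
    qed
  next
    fix K :: "'a set" assume K: "compact K"
    have "G -` K = F -` (T ` K)"
    proof (intro equalityI subsetI)
      fix p assume "p \<in> G -` K"
      then show "p \<in> F -` (T ` K)" using TG[of p] by (metis imageI vimageE vimageI)
    next
      fix p assume "p \<in> F -` (T ` K)"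
      then obtain k where "k \<in> K" "F p = T k" by auto
      then show "p \<in> G -` K" by (simp add: G_def JT)
    qed
    moreover have "compact (T ` K)" using linear_continuous_on[of T K] linT K
      by (intro compact_continuous_image) (auto simp: linear_conv_bounded_linear)
    ultimately show "compact (G -` K)" using proper unfolding proper_map_into_def by simp
  qed
  then have "bij_betw F UNIV {x. v \<bullet> x = 0}"
  proof -
    assume bij: "bij G"
    have "inj F"
    proof (rule injI)
      fix p q assume "F p = F q"
      then have "G p = G q" by (simp add: G_def)
      then show "p = q" using bij by (simp add: bij_def inj_def)
    qed
    moreover have "range F = {x. v \<bullet> x = 0}"
    proof (intro equalityI subsetI)
      fix x assume "x \<in> range F"
      then show "x \<in> {x. v \<bullet> x = 0}" using Fv by (auto simp: inner_commute)
    next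
      fix x assume x: "x \<in> {x. v \<bullet> x = 0}"
      obtain p where "G p = J x" using bij by (metis bij_def surjD)
      then have "F p = x" using TG[of p] TJ[of x] x by (simp add: inner_commute)
      then show "x \<in> range F" by blast
    qed
    ultimately show ?thesis by (simp add: bij_betw_def)
  qed
  moreover have "v \<noteq> 0" using vv by auto
  ultimately show ?thesis by blast
qed

end

theorem theorem1p4:
  fixes \<A> :: "('a::euclidean_space, 'm::{t2_space, second_countable_topology}) atlas"
    and F N :: "'m \<Rightarrow> 'b::euclidean_space"
    and a b c :: real
  assumes "DIM('b) = DIM('a) + 1"
    and "smooth_atlas \<A>"
    and "connected (UNIV :: 'm set)"
    and "immersion \<A> F"
    and "unit_normal_field \<A> F N"
    and "complete_immersion F"
    and "proper_map_into F"
    and "self_expander \<A> F"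
    and "\<And>p. c \<le> mean_curvature \<A> F N p"
    and "0 \<le> a" and "a < 1/2" and "b > 0"
    and "\<And>p. mean_curvature \<A> F N p \<le> a * norm (F p) + b"
    and "\<exists>\<alpha>. \<alpha> > 4 * a\<^sup>2 / (1 - 4 * a\<^sup>2) \<and>
           (\<forall>p. norm_sq_sff \<A> F p * mean_curvature \<A> F N p + mean_curvature \<A> F N p / 2
                  + (\<alpha> + 1) / 4 * scalar_sff \<A> F N p (tangential_part \<A> F p (F p))
                                                   (tangential_part \<A> F p (F p)) \<ge> 0)"
  shows "\<exists>v. v \<noteq> 0 \<and> bij_betw F UNIV {x. v \<bullet> x = 0}"
proof -
  from assms(14) obtain \<alpha> where \<alpha>: "\<alpha> > 4 * a\<^sup>2 / (1 - 4 * a\<^sup>2)"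
    and pinching: "\<And>p. norm_sq_sff \<A> F p * mean_curvature \<A> F N p + mean_curvature \<A> F N p / 2
      + (\<alpha> + 1) / 4 * scalar_sff \<A> F N p (tangential_part \<A> F p (F p)) (tangential_part \<A> F p (F p)) \<ge> 0"
    by blast
  interpret E: proper_expander \<A> F N by standard (use assms in auto)
  interpret pinched_expander \<A> F N a b c \<alpha>
    by standard (use assms \<alpha> pinching in \<open>simp_all add: E.H_def\<close>)
  have "conical_hypersurface \<A> F N"
  proof
    show "F p \<bullet> N p = 0" for p using H_zero[of p] E.H_eq[of p] by simp
  qed (use assms in auto)
  then show ?thesis by (rule conical_hypersurface.hyperplane)
qed

end
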